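(* Let $X$ be a $\mathrm{CAT}(0)$ space, let $\Gamma$ be a group acting geometrically on $X$, and let $\mathcal{F}$ be a $\Gamma$-invariant collection of unbounded, closed, convex subsets of $X$ such that: (A) there is a constant $D<\infty$ such that each flat in $X$ lies in the $D$-tubular neighborhood of some $C\in\mathcal{F}$; and (B) for each positive $r<\infty$ there is a constant $\rho=\rho(r)<\infty$ such that for any two distinct $C,C'\in\mathcal{F}$ we have $\operatorname{diam}\bigl(\mathcal{N}_r(C)\cap\mathcal{N}_r(C')\bigr)<\rho$. Let $X_\omega=\operatorname{Cone}_\omega(X,\star_n,\lambda_n)$ be an asymptotic cone of $X$, and let $\mathcal{F}_\omega$ be the set of all subspaces $C_\omega\subseteq X_\omega$ of the form $C_\omega=\omega\text{-}\lim C_n$ with $C_n\in\mathcal{F}$ and $\omega\text{-}\lim\lambda_n^{-1}d(C_n,\star_n)<\infty$. Suppose $C_\omega,C'_\omega\in\mathcal{F}_\omega$. If $C_\omega\neq C'_\omega$ then $C_\omega\cap C'_\omega$ contains at most one point.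
   Context: A group action on $X$ is geometric if it is isometric, cocompact and proper (each $x\in X$ has a ball $B(x,r)$, $r>0$, such that $\{g : gB(x,r)\cap B(x,r)\ne\emptyset\}$ is finite). A flat in $X$ is an isometrically embedded copy of Euclidean space $\mathbb{E}^k$ with $k\ge 2$. $\mathcal{N}_r(C)$ denotes the $r$-tubular neighborhood of $C$. $\operatorname{Cone}_\omega(X,\star_n,\lambda_n)$ is the ultralimit of the pointed spaces $(X,\lambda_n^{-1}d,\star_n)$, where $\omega$ is a nonprincipal ultrafilter on $\mathbb{N}$, $\star_n\in X$, $\lambda_n>0$ and $\omega\text{-}\lim\lambda_n=\infty$. For subsets $C_n\subseteq X$, $\omega\text{-}\lim C_n\subseteq X_\omega$ is the set of points represented by sequences $(x_n)$ with $x_n\in C_n$. *)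

theory Defs
  imports "HOL-Analysis.Analysis" "HOL-Algebra.Group_Action"
begin

section \<open>CAT(0) spaces\<close>

definition geodesic_segment :: "'a::metric_space \<Rightarrow> 'a \<Rightarrow> 'a set \<Rightarrow> bool" where
  "geodesic_segment p q S \<longleftrightarrow>
     (\<exists>c :: real \<Rightarrow> 'a. c 0 = p \<and> c (dist p q) = q \<and> S = c ` {0..dist p q} \<and>
        (\<forall>s\<in>{0..dist p q}. \<forall>t\<in>{0..dist p q}. dist (c s) (c t) = \<bar>s - t\<bar>))"

text \<open>\<open>x'\<close> is the comparison point on the Euclidean segment from \<open>p'\<close> to \<open>q'\<close>
  of the point \<open>x\<close> on the geodesic segment \<open>S\<close> from \<open>p\<close> to \<open>q\<close>.\<close>

definition comparison_point ::
  "'a::metric_space \<Rightarrow> 'a set \<Rightarrow> real^2 \<Rightarrow> real^2 \<Rightarrow> 'a \<Rightarrow> real^2 \<Rightarrow> bool" where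
  "comparison_point p S p' q' x x' \<longleftrightarrow>
     x \<in> S \<and> x' \<in> closed_segment p' q' \<and> dist p' x' = dist p x"

definition CAT0_space :: "'a::metric_space itself \<Rightarrow> bool" where
  "CAT0_space _ \<longleftrightarrow>
     (\<forall>p q :: 'a. \<exists>S. geodesic_segment p q S) \<and>
     (\<forall>(p :: 'a) q r S\<^sub>1 S\<^sub>2 S\<^sub>3 p' q' r' x y x' y'.
        geodesic_segment p q S\<^sub>1 \<and> geodesic_segment q r S\<^sub>2 \<and> geodesic_segment r p S\<^sub>3 \<and>
        dist p' q' = dist p q \<and> dist q' r' = dist q r \<and> dist r' p' = dist r p \<and>
        (comparison_point p S\<^sub>1 p' q' x x' \<or> comparison_point q S\<^sub>2 q' r' x x' \<or>
         comparison_point r S\<^sub>3 r' p' x x') \<and>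
        (comparison_point p S\<^sub>1 p' q' y y' \<or> comparison_point q S\<^sub>2 q' r' y y' \<or>
         comparison_point r S\<^sub>3 r' p' y y')
        \<longrightarrow> dist x y \<le> dist x' y')"

definition geodesically_convex :: "'a::metric_space set \<Rightarrow> bool" where
  "geodesically_convex C \<longleftrightarrow>
     (\<forall>p\<in>C. \<forall>q\<in>C. \<forall>S. geodesic_segment p q S \<longrightarrow> S \<subseteq> C)"

text \<open>Since the dimension \<open>k\<close> is existentially quantified, Euclidean \<open>k\<close>-space is realised on the
  carrier of \<^const>\<open>Euclidean_space\<close>, i.e. the sequences vanishing from index \<open>k\<close> on.\<close>

definition flat :: "'a::metric_space set \<Rightarrow> bool" where
  "flat S \<longleftrightarrow>
     (\<exists>k\<ge>2. \<exists>f. S = f ` topspace (Euclidean_space k) \<and>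
        (\<forall>u\<in>topspace (Euclidean_space k). \<forall>v\<in>topspace (Euclidean_space k).
           dist (f u) (f v) = L2_set (\<lambda>i. u i - v i) {..<k}))"

definition tubular_nbhd :: "real \<Rightarrow> 'a::metric_space set \<Rightarrow> 'a set" where
  "tubular_nbhd r C = (\<Union>c\<in>C. ball c r)"


section \<open>Geometric actions\<close>

definition geometric_action ::
  "('g, 'm) monoid_scheme \<Rightarrow> ('g \<Rightarrow> 'a::metric_space \<Rightarrow> 'a) \<Rightarrow> bool" where
  "geometric_action G \<phi> \<longleftrightarrow>
     group_action G UNIV \<phi> \<and>
     (\<forall>g\<in>carrier G. \<forall>x y. dist (\<phi> g x) (\<phi> g y) = dist x y) \<and>
     (\<exists>K. compact K \<and> (\<Union>g\<in>carrier G. \<phi> g ` K) = UNIV) \<and>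
     (\<forall>x. \<exists>r>0. finite {g \<in> carrier G. \<phi> g ` ball x r \<inter> ball x r \<noteq> {}})"


section \<open>Asymptotic cones\<close>

definition nonprincipal_ultrafilter :: "'i filter \<Rightarrow> bool" where
  "nonprincipal_ultrafilter \<omega> \<longleftrightarrow>
     \<omega> \<noteq> bot \<and> (\<forall>P. eventually P \<omega> \<or> eventually (\<lambda>i. \<not> P i) \<omega>) \<and>
     (\<forall>i. \<omega> \<noteq> principal {i})"

text \<open>Ultralimits of real sequences are taken in the compact space of extended reals, where
  they always exist.\<close>

definition ulim :: "nat filter \<Rightarrow> (nat \<Rightarrow> real) \<Rightarrow> ereal" where
  "ulim \<omega> f = Lim \<omega> (\<lambda>n. ereal (f n))"

definition cone_dist ::
  "nat filter \<Rightarrow> (nat \<Rightarrow> real) \<Rightarrow> (nat \<Rightarrow> 'a::metric_space) \<Rightarrow> (nat \<Rightarrow> 'a) \<Rightarrow> ereal" where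
  "cone_dist \<omega> lam x y = ulim \<omega> (\<lambda>n. dist (x n) (y n) / lam n)"

definition cone_seqs ::
  "nat filter \<Rightarrow> (nat \<Rightarrow> 'a::metric_space) \<Rightarrow> (nat \<Rightarrow> real) \<Rightarrow> (nat \<Rightarrow> 'a) set" where
  "cone_seqs \<omega> star lam = {x. cone_dist \<omega> lam x star < \<infinity>}"

definition cone_rel ::
  "nat filter \<Rightarrow> (nat \<Rightarrow> 'a::metric_space) \<Rightarrow> (nat \<Rightarrow> real) \<Rightarrow> ((nat \<Rightarrow> 'a) \<times> (nat \<Rightarrow> 'a)) set" where
  "cone_rel \<omega> star lam =
     {(x, y). x \<in> cone_seqs \<omega> star lam \<and> y \<in> cone_seqs \<omega> star lam \<and> cone_dist \<omega> lam x y = 0}"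

text \<open>The points of the cone are the equivalence classes of sequences.\<close>

definition asymptotic_cone ::
  "nat filter \<Rightarrow> (nat \<Rightarrow> 'a::metric_space) \<Rightarrow> (nat \<Rightarrow> real) \<Rightarrow> (nat \<Rightarrow> 'a) set set" where
  "asymptotic_cone \<omega> star lam = cone_seqs \<omega> star lam // cone_rel \<omega> star lam"

definition ulim_set ::
  "nat filter \<Rightarrow> (nat \<Rightarrow> 'a::metric_space) \<Rightarrow> (nat \<Rightarrow> real) \<Rightarrow> (nat \<Rightarrow> 'a set) \<Rightarrow>
     (nat \<Rightarrow> 'a) set set" where
  "ulim_set \<omega> star lam C = {P \<in> asymptotic_cone \<omega> star lam. \<exists>x\<in>P. \<forall>n. x n \<in> C n}"

definition cone_family ::
  "nat filter \<Rightarrow> (nat \<Rightarrow> 'a::metric_space) \<Rightarrow> (nat \<Rightarrow> real) \<Rightarrow> 'a set set \<Rightarrow>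
     (nat \<Rightarrow> 'a) set set set" where
  "cone_family \<omega> star lam \<F> =
     {ulim_set \<omega> star lam C |C.
        (\<forall>n. C n \<in> \<F>) \<and> ulim \<omega> (\<lambda>n. infdist (star n) (C n) / lam n) < \<infinity>}"

lemma ulim_tendsto:
  assumes "nonprincipal_ultrafilter \<omega>"
  shows "((\<lambda>n. ereal (f n)) \<longlongrightarrow> ulim \<omega> f) \<omega>"
proof -
  let ?g = "\<lambda>n. ereal (f n)"
  have ne: "\<omega> \<noteq> bot" and ultra: "eventually P \<omega> \<or> eventually (\<lambda>i. \<not> P i) \<omega>" for P
    using assms by (auto simp: nonprincipal_ultrafilter_def)
  have "filtermap ?g \<omega> \<noteq> bot"
    using ne by (simp add: filtermap_bot_iff)
  moreover have "eventually (\<lambda>x. x \<in> UNIV) (filtermap ?g \<omega>)"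
    by simp
  ultimately obtain l where l: "inf (nhds l) (filtermap ?g \<omega>) \<noteq> bot"
    using compact_filter[of "UNIV :: ereal set"] compact_UNIV by blast
  have "(?g \<longlongrightarrow> l) \<omega>"
  proof (rule topological_tendstoI)
    fix S assume S: "open S" "l \<in> S"
    show "eventually (\<lambda>n. ?g n \<in> S) \<omega>"
    proof (rule ccontr)
      assume "\<not> eventually (\<lambda>n. ?g n \<in> S) \<omega>"
      then have "eventually (\<lambda>x. x \<notin> S) (filtermap ?g \<omega>)"
        using ultra by (auto simp: eventually_filtermap)
      moreover have "eventually (\<lambda>x. x \<in> S) (nhds l)"
        using S by (rule eventually_nhds_in_open)
      ultimately have "eventually (\<lambda>x. False) (inf (nhds l) (filtermap ?g \<omega>))"
        unfolding eventually_inf by blast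
      with l show False by (simp add: trivial_limit_def)
    qed
  qed
  with ne show ?thesis
    unfolding ulim_def using tendsto_Lim by fastforce
qed

lemma cone_dist_nonneg:
  assumes "nonprincipal_ultrafilter \<omega>" "\<And>n. lam n > 0"
  shows "0 \<le> cone_dist \<omega> lam x y"
proof (rule tendsto_lowerbound)
  show "((\<lambda>n. ereal (dist (x n) (y n) / lam n)) \<longlongrightarrow> cone_dist \<omega> lam x y) \<omega>"
    unfolding cone_dist_def by (rule ulim_tendsto[OF assms(1)])
  show "\<forall>\<^sub>F n in \<omega>. 0 \<le> ereal (dist (x n) (y n) / lam n)"
    using assms(2) by (simp add: less_imp_le)
  show "\<omega> \<noteq> bot" using assms(1) by (simp add: nonprincipal_ultrafilter_def)
qed

lemma cone_dist_commute: "cone_dist \<omega> lam x y = cone_dist \<omega> lam y x"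
  by (simp add: cone_dist_def dist_commute)

lemma cone_dist_refl:
  assumes "nonprincipal_ultrafilter \<omega>"
  shows "cone_dist \<omega> lam x x = 0"
  using assms tendsto_Lim[of \<omega> "\<lambda>n. 0::ereal" 0]
  by (simp add: cone_dist_def ulim_def nonprincipal_ultrafilter_def zero_ereal_def[symmetric])

lemma cone_dist_triangle:
  assumes "nonprincipal_ultrafilter \<omega>" "\<And>n. lam n > 0"
  shows "cone_dist \<omega> lam x z \<le> cone_dist \<omega> lam x y + cone_dist \<omega> lam y z"
proof (rule tendsto_le)
  show "\<omega> \<noteq> bot" using assms(1) by (simp add: nonprincipal_ultrafilter_def)
  show "((\<lambda>n. ereal (dist (x n) (z n) / lam n)) \<longlongrightarrow> cone_dist \<omega> lam x z) \<omega>"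
    unfolding cone_dist_def by (rule ulim_tendsto[OF assms(1)])
  show "((\<lambda>n. ereal (dist (x n) (y n) / lam n) + ereal (dist (y n) (z n) / lam n)) \<longlongrightarrow>
          cone_dist \<omega> lam x y + cone_dist \<omega> lam y z) \<omega>"
    using cone_dist_nonneg[where lam = lam and x = x and y = y, OF assms] cone_dist_nonneg[where lam = lam and x = y and y = z, OF assms]
    by (intro tendsto_add_ereal_nonneg)
       (auto simp: cone_dist_def intro: ulim_tendsto[OF assms(1)])
  show "\<forall>\<^sub>F n in \<omega>. ereal (dist (x n) (z n) / lam n)
          \<le> ereal (dist (x n) (y n) / lam n) + ereal (dist (y n) (z n) / lam n)"
  proof (intro always_eventually allI)
    fix n
    have "dist (x n) (z n) / lam n \<le> (dist (x n) (y n) + dist (y n) (z n)) / lam n"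
      using assms(2)[of n] by (intro divide_right_mono dist_triangle) simp
    then show "ereal (dist (x n) (z n) / lam n)
                 \<le> ereal (dist (x n) (y n) / lam n) + ereal (dist (y n) (z n) / lam n)"
      by (simp add: add_divide_distrib)
  qed
qed

lemma equiv_cone_rel:
  assumes "nonprincipal_ultrafilter \<omega>" "\<And>n. lam n > 0"
  shows "equiv (cone_seqs \<omega> star lam) (cone_rel \<omega> star lam)"
proof (rule equivI)
  show "refl_on (cone_seqs \<omega> star lam) (cone_rel \<omega> star lam)"
    using cone_dist_refl[OF assms(1)] by (auto simp: refl_on_def cone_rel_def)
  show "sym (cone_rel \<omega> star lam)"
    by (auto simp: sym_def cone_rel_def cone_dist_commute)
  show "trans (cone_rel \<omega> star lam)"
  proof (rule transI)
    fix x y z assume "(x, y) \<in> cone_rel \<omega> star lam" "(y, z) \<in> cone_rel \<omega> star lam"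
    then show "(x, z) \<in> cone_rel \<omega> star lam"
      using cone_dist_triangle[where lam = lam and x = x and y = y and z = z, OF assms] cone_dist_nonneg[where lam = lam and x = x and y = z, OF assms]
      by (auto simp: cone_rel_def)
  qed
  show "cone_rel \<omega> star lam \<subseteq> cone_seqs \<omega> star lam \<times> cone_seqs \<omega> star lam"
    by (auto simp: cone_rel_def)
qed

end

theory Submission
  imports Defs
begin

text \<open>
  Suppose that two different members \<open>C\<^sub>\<omega>\<close> and \<open>C\<^sub>\<omega>'\<close> of the limit
  family share two points. In \<open>X\<close> this means that there are distinct sets \<open>C\<close>, \<open>C'\<close> in the
  family and segments of arbitrarily large length \<open>L\<close>, with one segment in \<open>C'\<close>, whose endpoints
  are at distance \<open>o(L)\<close> from \<open>C\<close>. By (B) such a segment can be within a fixed distance of \<open>C\<close>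
  only along a bounded part, so a definite proportion of it is far away from \<open>C\<close>. The nearest
  point projection to \<open>C\<close> does not increase distances and, because the endpoints are relatively
  close to \<open>C\<close>, it loses only \<open>o(L)\<close> of the length. By the pigeonhole principle there is a piece
  of prescribed length on which it is isometric up to an arbitrarily small error. The geodesics
  joining the points of that piece to their projections form a \<^emph>\<open>fence\<close>
  (\<open>fence_between_long_thin_pair\<close>): a long row of long posts that stand perpendicularly on \<open>C\<close>
  and keep nearly constant distances from each other near their feet.

  The action is cocompact and \<open>X\<close> is proper, so larger and larger fences can be translated to a
  fixed compact set and have an ultralimit. That limit is a flat half-plane
  (\<open>fences_converge_to_half_plane\<close>): the quadrilateral inequality and Stewart's inequality take
  the place of angles and determine all distances (\<open>half_plane_isometric\<close>). Translating points
  that lie deeper and deeper in the half-plane produces flats, so by (A) the half-plane is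
  locally, at large depth, near members of the family. By (B) neighbouring members coincide, and
  thus, at every sufficiently large height, evenly spaced points along a whole horizontal ray
  are within \<open>D + 1\<close> of one single member \<open>E\<close> (\<open>deep_line_near_member\<close>). The same points are at
  bounded distance from the bottom of the half-plane, hence long stretches of them are at
  bounded distance from the translates of the sets \<open>C\<close> on which the fences stand, so (B) again
  shows that \<open>E\<close> is one of these translates. But the posts leave \<open>C\<close> at unit speed, so that at
  large height they are not within \<open>D + 1\<close> of it: a contradiction
  (\<open>no_arbitrarily_large_fences\<close>).
\<close>

section \<open>Comparison inequalities in CAT(0) spaces\<close>

definition unit_speed :: "(real \<Rightarrow> 'a::metric_space) \<Rightarrow> real \<Rightarrow> bool" where
  "unit_speed c l \<longleftrightarrow> (\<forall>s\<in>{0..l}. \<forall>t\<in>{0..l}. dist (c s) (c t) = \<bar>s - t\<bar>)"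

lemma unit_speedD: "unit_speed c l \<Longrightarrow> 0 \<le> s \<Longrightarrow> s \<le> l \<Longrightarrow> 0 \<le> t \<Longrightarrow> t \<le> l \<Longrightarrow> dist (c s) (c t) = \<bar>s - t\<bar>"
  by (auto simp: unit_speed_def)

lemma CAT0_geodesic:
  fixes p q :: "'a::metric_space"
  assumes "CAT0_space TYPE('a)"
  obtains c where "c 0 = p" "c (dist p q) = q" "unit_speed c (dist p q)"
    "geodesic_segment p q (c ` {0..dist p q})"
proof -
  from assms obtain S where S: "geodesic_segment p q S" unfolding CAT0_space_def by blast
  then obtain c where "c 0 = p" "c (dist p q) = q" "S = c ` {0..dist p q}" "unit_speed c (dist p q)"
    unfolding geodesic_segment_def unit_speed_def by blast
  with S that show thesis by blast
qed

lemma dist_vector_2: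
  "dist (vector [a, b] :: real^2) (vector [c, d]) = sqrt ((a - c)\<^sup>2 + (b - d)\<^sup>2)"
  by (simp add: dist_norm norm_vec_def L2_set_def sum_2)

text \<open>
  Compare \<open>x\<close>, a vertex of the triangle, with a point of the opposite side. With the comparison
  triangle in coordinates, its base on the first axis, the law of cosines turns the comparison
  inequality into Stewart's formula. This is the only place where comparison triangles are used.
\<close>

lemma CAT0_stewart_geodesic:
  fixes p q x :: "'a::metric_space"
  assumes cat: "CAT0_space TYPE('a)" and \<theta>: "0 \<le> \<theta>" "\<theta> \<le> 1"
    and c: "c 0 = p" "c (dist p q) = q" "unit_speed c (dist p q)"
      "geodesic_segment p q (c ` {0..dist p q})"
  shows "(dist x (c (\<theta> * dist p q)))\<^sup>2
    \<le> (1 - \<theta>) * (dist x p)\<^sup>2 + \<theta> * (dist x q)\<^sup>2 - \<theta> * (1 - \<theta>) * (dist p q)\<^sup>2"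
proof (cases "p = q")
  case True
  then show ?thesis using c by (simp add: algebra_simps)
next
  case False
  define d where "d = dist p q"
  define a where "a = dist x q"
  define b where "b = dist x p"
  define u where "u = (b\<^sup>2 + d\<^sup>2 - a\<^sup>2) / (2 * d)"
  define v where "v = sqrt (b\<^sup>2 - u\<^sup>2)"
  have d: "d > 0" using False by (simp add: d_def)
  have ab: "a \<ge> 0" "b \<ge> 0" by (auto simp: a_def b_def)
  have tri: "d \<le> a + b" "a \<le> b + d" "b \<le> a + d"
    using dist_triangle[of p q x] dist_triangle[of x q p] dist_triangle[of x p q]
    by (simp_all add: a_def b_def d_def dist_commute)
  \<comment> \<open>law of cosines: \<open>u\<close> is the first coordinate of the apex\<close>
  have ud: "2 * u * d = b\<^sup>2 + d\<^sup>2 - a\<^sup>2" using d by (simp add: u_def)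
  \<comment> \<open>so that \<open>b\<^sup>2 - u\<^sup>2\<close> has a real square root; this is where the triangle inequalities enter\<close>
  have "\<bar>u\<bar> \<le> b"
  proof -
    have "(b + d)\<^sup>2 \<ge> a\<^sup>2" using tri ab by (intro power_mono) auto
    then have "2 * u * d \<ge> 2 * d * (- b)" unfolding ud by (simp add: power2_eq_square algebra_simps)
    then have "(2 * d) * (- b) \<le> (2 * d) * u" by (simp add: mult_ac)
    then have 1: "- b \<le> u" using d mult_le_cancel_left_pos[of "2 * d" "- b" u] by linarith
    have "\<bar>b - d\<bar>\<^sup>2 \<le> a\<^sup>2" using tri ab by (intro power_mono) auto
    then have "2 * u * d \<le> 2 * d * b" unfolding ud by (simp add: power2_eq_square algebra_simps)
    then have "(2 * d) * u \<le> (2 * d) * b" by (simp add: mult_ac)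
    then have 2: "u \<le> b" using d mult_le_cancel_left_pos[of "2 * d" u b] by linarith
    from 1 2 show ?thesis by linarith
  qed
  then have "u\<^sup>2 \<le> b\<^sup>2" using power_mono[of "\<bar>u\<bar>" b 2] by simp
  then have v2: "v\<^sup>2 = b\<^sup>2 - u\<^sup>2" by (simp add: v_def)
  define p' q' x' m' :: "real^2" where "p' = vector [0, 0]" and "q' = vector [d, 0]"
    and "x' = vector [u, v]" and "m' = vector [\<theta> * d, 0]"
  have pq': "dist p' q' = dist p q" using d by (simp add: p'_def q'_def dist_vector_2 d_def)
  have "(u - d)\<^sup>2 + v\<^sup>2 = a\<^sup>2" using ud by (simp add: v2 power2_diff)
  then have qx': "dist q' x' = dist q x"
    by (simp add: q'_def x'_def dist_vector_2 power2_commute[of d] ab dist_commute[of q] flip: a_def)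
  have "dist x' p' = sqrt (u\<^sup>2 + v\<^sup>2)" by (simp add: p'_def x'_def dist_vector_2)
  also have "u\<^sup>2 + v\<^sup>2 = b\<^sup>2" by (simp add: v2)
  also have "sqrt (b\<^sup>2) = dist x p" by (simp add: b_def)
  finally have xp': "dist x' p' = dist x p" .
  have m': "m' \<in> closed_segment p' q'" "dist p' m' = \<theta> * d"
  proof -
    have "m' = (1 - \<theta>) *\<^sub>R p' + \<theta> *\<^sub>R q'"
      by (simp add: m'_def p'_def q'_def vec_eq_iff forall_2)
    then show "m' \<in> closed_segment p' q'" using \<theta> by (auto simp: in_segment)
    show "dist p' m' = \<theta> * d" using \<theta> d by (simp add: m'_def p'_def dist_vector_2)
  qed
  define m where "m = c (\<theta> * dist p q)"
  have td: "0 \<le> \<theta> * d" "\<theta> * d \<le> d" using \<theta> d mult_left_le_one_le[of d \<theta>] by auto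
  have "dist p m = \<theta> * d"
    using unit_speedD[OF c(3), of 0 "\<theta> * d"] td c(1) by (simp add: m_def d_def)
  then have cm: "comparison_point p (c ` {0..dist p q}) p' q' m m'"
    unfolding comparison_point_def using m' td by (auto simp: m_def d_def)
  obtain c2 where c2: "c2 0 = q" "geodesic_segment q x (c2 ` {0..dist q x})"
    using CAT0_geodesic[OF cat] by metis
  obtain c3 where c3: "c3 0 = x" "geodesic_segment x p (c3 ` {0..dist x p})"
    using CAT0_geodesic[OF cat] by metis
  have "x \<in> c3 ` {0..dist x p}" using c3(1) by (intro image_eqI[of _ _ 0]) auto
  then have cx: "comparison_point x (c3 ` {0..dist x p}) x' p' x x'"
    unfolding comparison_point_def by simp
  have "dist x m \<le> dist x' m'"
    using cat c(4) c2(2) c3(2) pq' qx' xp' cm cx unfolding CAT0_space_def by blast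
  then have "(dist x m)\<^sup>2 \<le> (dist x' m')\<^sup>2" by (intro power_mono) auto
  also have "\<dots> = (u - \<theta> * d)\<^sup>2 + v\<^sup>2" by (simp add: x'_def m'_def dist_vector_2)
  also have "\<dots> = b\<^sup>2 - \<theta> * (2 * u * d) + \<theta>\<^sup>2 * d\<^sup>2"
    unfolding v2 by (simp add: power2_eq_square algebra_simps)
  also have "\<dots> = (1 - \<theta>) * b\<^sup>2 + \<theta> * a\<^sup>2 - \<theta> * (1 - \<theta>) * d\<^sup>2"
    unfolding ud by (simp add: power2_eq_square algebra_simps)
  finally show ?thesis by (simp add: m_def a_def b_def d_def)
qed

text \<open>
  Stated through distances only, so that no geodesic has to be mentioned. In a CAT(0) space
  these conditions determine \<open>m\<close>, because geodesics are unique.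
\<close>

definition at_ratio :: "real \<Rightarrow> 'a::metric_space \<Rightarrow> 'a \<Rightarrow> 'a \<Rightarrow> bool" where
  "at_ratio \<theta> p q m \<longleftrightarrow> 0 \<le> \<theta> \<and> \<theta> \<le> 1 \<and> dist p m = \<theta> * dist p q \<and> dist m q = (1 - \<theta>) * dist p q"

lemma unit_speed_at_ratio:
  assumes "unit_speed c l" "0 \<le> s" "s \<le> t" "t \<le> u" "u \<le> l" "s < u"
  shows "at_ratio ((t - s) / (u - s)) (c s) (c u) (c t)"
proof -
  have "1 - (t - s) / (u - s) = (u - t) / (u - s)" using assms by (simp add: field_simps)
  with assms show ?thesis by (simp add: at_ratio_def unit_speedD)
qed

lemma CAT0_point_at_ratio:
  fixes p q :: "'a::metric_space"
  assumes cat: "CAT0_space TYPE('a)" and \<theta>: "0 \<le> \<theta>" "\<theta> \<le> 1"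
  shows "\<exists>m. at_ratio \<theta> p q m \<and> (\<forall>C. geodesically_convex C \<longrightarrow> p \<in> C \<longrightarrow> q \<in> C \<longrightarrow> m \<in> C) \<and>
    (\<forall>x. (dist x m)\<^sup>2 \<le> (1 - \<theta>) * (dist x p)\<^sup>2 + \<theta> * (dist x q)\<^sup>2 - \<theta> * (1 - \<theta>) * (dist p q)\<^sup>2)"
proof -
  obtain c where c: "c 0 = p" "c (dist p q) = q" "unit_speed c (dist p q)"
    "geodesic_segment p q (c ` {0..dist p q})"
    using CAT0_geodesic[OF cat] by blast
  have td: "0 \<le> \<theta> * dist p q" "\<theta> * dist p q \<le> dist p q"
    using \<theta> mult_left_le_one_le[of "dist p q" \<theta>] by auto
  have "at_ratio \<theta> p q (c (\<theta> * dist p q))"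
    unfolding at_ratio_def
    using unit_speedD[OF c(3), of 0 "\<theta> * dist p q"] unit_speedD[OF c(3), of "\<theta> * dist p q"
      "dist p q"] td c(1,2) \<theta>
    by (simp add: algebra_simps)
  moreover have "c (\<theta> * dist p q) \<in> C" if "geodesically_convex C" "p \<in> C" "q \<in> C" for C
    using that c(4) td unfolding geodesically_convex_def by fastforce
  moreover note CAT0_stewart_geodesic[OF cat \<theta> c]
  ultimately show ?thesis by blast
qed

text \<open>
  The inequality for the point of a chosen geodesic, applied to \<open>m\<close> itself, shows that \<open>m\<close> is
  that point.
\<close>

lemma CAT0_stewart:
  fixes p q x :: "'a::metric_space"
  assumes cat: "CAT0_space TYPE('a)" and m: "at_ratio \<theta> p q m"
  shows "(dist x m)\<^sup>2 \<le> (1 - \<theta>) * (dist x p)\<^sup>2 + \<theta> * (dist x q)\<^sup>2 - \<theta> * (1 - \<theta>) * (dist p q)\<^sup>2"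
proof -
  have \<theta>: "0 \<le> \<theta>" "\<theta> \<le> 1" using m by (auto simp: at_ratio_def)
  obtain n where n: "\<And>x. (dist x n)\<^sup>2
    \<le> (1 - \<theta>) * (dist x p)\<^sup>2 + \<theta> * (dist x q)\<^sup>2 - \<theta> * (1 - \<theta>) * (dist p q)\<^sup>2"
    using CAT0_point_at_ratio[OF cat \<theta>, of p q] by blast
  have "(dist m n)\<^sup>2
    \<le> (1 - \<theta>) * (\<theta> * dist p q)\<^sup>2 + \<theta> * ((1 - \<theta>) * dist p q)\<^sup>2 - \<theta> * (1 - \<theta>) * (dist p q)\<^sup>2"
    using n[of m] m by (simp add: at_ratio_def dist_commute)
  also have "\<dots> = 0" by (simp add: power2_eq_square algebra_simps)
  finally have "m = n" by simp
  then show ?thesis using n by simp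
qed

text \<open>
  Apply Stewart's inequality to the midpoint of one diagonal, seen from both ends of the other
  one.
\<close>

lemma CAT0_quadrilateral:
  fixes p q r s :: "'a::metric_space"
  assumes cat: "CAT0_space TYPE('a)"
  shows "(dist p r)\<^sup>2 + (dist q s)\<^sup>2 \<le> (dist p q)\<^sup>2 + (dist q r)\<^sup>2 + (dist r s)\<^sup>2 + (dist s p)\<^sup>2"
proof -
  define h :: real where "h = 1/2"
  have "0 \<le> h" "h \<le> 1" by (auto simp: h_def)
  then obtain m where
    "\<And>x. (dist x m)\<^sup>2 \<le> (1 - h) * (dist x p)\<^sup>2 + h * (dist x r)\<^sup>2 - h * (1 - h) * (dist p r)\<^sup>2"
    using CAT0_point_at_ratio[OF cat, of h p r] by blast
  then have m: "(dist x m)\<^sup>2 \<le> (dist x p)\<^sup>2 / 2 + (dist x r)\<^sup>2 / 2 - (dist p r)\<^sup>2 / 4" for x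
    by (simp add: h_def)
  have "(dist q s)\<^sup>2 \<le> (dist q m + dist s m)\<^sup>2"
    by (intro power_mono dist_triangle2) auto
  also have "\<dots> \<le> 2 * (dist q m)\<^sup>2 + 2 * (dist s m)\<^sup>2"
    using zero_le_power2[of "dist q m - dist s m"] by (simp add: power2_eq_square algebra_simps)
  finally show ?thesis using m[of q] m[of s] by (simp add: dist_commute)
qed

text \<open>
  Stewart's inequality, used first for \<open>u\<close> as seen from \<open>r\<close> and then for \<open>v\<close> as seen from \<open>u\<close>.
\<close>

lemma CAT0_triangle_ratio:
  fixes p q r :: "'a::metric_space"
  assumes cat: "CAT0_space TYPE('a)" and u: "at_ratio \<theta> p q u" and v: "at_ratio \<theta> p r v"
  shows "dist u v \<le> \<theta> * dist q r"
proof -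
  have \<theta>: "0 \<le> \<theta>" "\<theta> \<le> 1" using u by (auto simp: at_ratio_def)
  \<comment> \<open>the two applications of Stewart's inequality combine to the claim by this identity\<close>
  have ident: "(1 - \<theta>) * (\<theta> * a)\<^sup>2 + \<theta> * ((1 - \<theta>) * b\<^sup>2 + \<theta> * c\<^sup>2 - \<theta> * (1 - \<theta>) * a\<^sup>2)
      - \<theta> * (1 - \<theta>) * b\<^sup>2 = (\<theta> * c)\<^sup>2" for a b c :: real
    by (simp add: power2_eq_square algebra_simps)
  have "(dist u v)\<^sup>2 \<le> (1 - \<theta>) * (dist u p)\<^sup>2 + \<theta> * (dist u r)\<^sup>2 - \<theta> * (1 - \<theta>) * (dist p r)\<^sup>2"
    by (rule CAT0_stewart[OF cat v])
  also have "dist u p = \<theta> * dist p q" using u by (simp add: at_ratio_def dist_commute)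
  also have "\<theta> * (dist u r)\<^sup>2
      \<le> \<theta> * ((1 - \<theta>) * (dist r p)\<^sup>2 + \<theta> * (dist r q)\<^sup>2 - \<theta> * (1 - \<theta>) * (dist p q)\<^sup>2)"
    using CAT0_stewart[OF cat u, of r] \<theta> by (intro mult_left_mono) (simp_all only: dist_commute[of u r])
  finally have "(dist u v)\<^sup>2 \<le> (1 - \<theta>) * (\<theta> * dist p q)\<^sup>2
      + \<theta> * ((1 - \<theta>) * (dist r p)\<^sup>2 + \<theta> * (dist r q)\<^sup>2 - \<theta> * (1 - \<theta>) * (dist p q)\<^sup>2)
      - \<theta> * (1 - \<theta>) * (dist r p)\<^sup>2"
    by (simp only: dist_commute[of p r])
  also have "\<dots> = (\<theta> * dist r q)\<^sup>2"
    by (rule ident)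
  finally have "(dist u v)\<^sup>2 \<le> (\<theta> * dist q r)\<^sup>2" by (simp add: dist_commute)
  moreover have "0 \<le> \<theta> * dist q r" using \<theta> by simp
  ultimately show ?thesis by (rule power2_le_imp_le)
qed

text \<open>
  A diagonal cuts the quadrilateral into two triangles, and each of them contributes one
  summand.
\<close>

lemma CAT0_convex_metric:
  fixes p q p' q' :: "'a::metric_space"
  assumes cat: "CAT0_space TYPE('a)" and u: "at_ratio \<theta> p q u" and v: "at_ratio \<theta> p' q' v"
  shows "dist u v \<le> (1 - \<theta>) * dist p p' + \<theta> * dist q q'"
proof -
  have \<theta>: "0 \<le> \<theta>" "\<theta> \<le> 1" using u by (auto simp: at_ratio_def)
  obtain m where m: "at_ratio \<theta> p q' m" using CAT0_point_at_ratio[OF cat \<theta>, of p q'] by blast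
  have "dist u m \<le> \<theta> * dist q q'" by (rule CAT0_triangle_ratio[OF cat u m])
  moreover have "at_ratio (1 - \<theta>) q' p m" "at_ratio (1 - \<theta>) q' p' v"
    using m v by (auto simp: at_ratio_def dist_commute)
  then have "dist m v \<le> (1 - \<theta>) * dist p p'" by (rule CAT0_triangle_ratio[OF cat])
  ultimately show ?thesis using dist_triangle[of u v m] by linarith
qed

definition nearest :: "'a::metric_space set \<Rightarrow> 'a \<Rightarrow> 'a \<Rightarrow> bool" where
  "nearest C x c \<longleftrightarrow> c \<in> C \<and> (\<forall>z\<in>C. dist x c \<le> dist x z)"

text \<open>
  The angle at the foot \<open>c\<close> of a perpendicular is at least a right angle: moving from \<open>c\<close> a
  little towards \<open>z\<close> stays in \<open>C\<close>, hence does not come closer to \<open>x\<close>, and Stewart's inequality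
  makes this quantitative.
\<close>

lemma nearest_obtuse:
  fixes C :: "'a::metric_space set"
  assumes cat: "CAT0_space TYPE('a)" and conv: "geodesically_convex C" and c: "nearest C x c"
    and z: "z \<in> C"
  shows "(dist x c)\<^sup>2 + (dist c z)\<^sup>2 \<le> (dist x z)\<^sup>2"
proof -
  have *: "(dist x c)\<^sup>2 + (1 - \<theta>) * (dist c z)\<^sup>2 \<le> (dist x z)\<^sup>2" if \<theta>: "0 < \<theta>" "\<theta> < 1" for \<theta>
  proof -
    have \<theta>': "0 \<le> \<theta>" "\<theta> \<le> 1" using \<theta> by auto
    obtain m where m: "at_ratio \<theta> c z m" and "m \<in> C"
      using CAT0_point_at_ratio[OF cat \<theta>', of c z] conv c z by (auto simp: nearest_def)
    have m2: "(dist x m)\<^sup>2 \<le> (1 - \<theta>) * (dist x c)\<^sup>2 + \<theta> * (dist x z)\<^sup>2 - \<theta> * (1 - \<theta>) * (dist c z)\<^sup>2"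
      by (rule CAT0_stewart[OF cat m])
    have "(dist x c)\<^sup>2 \<le> (dist x m)\<^sup>2"
      using c \<open>m \<in> C\<close> by (auto simp: nearest_def intro!: power_mono)
    also note m2
    finally have "\<theta> * (dist x c)\<^sup>2 + \<theta> * (1 - \<theta>) * (dist c z)\<^sup>2 \<le> \<theta> * (dist x z)\<^sup>2"
      by (simp only: left_diff_distrib mult_1)
    then have "\<theta> * ((dist x c)\<^sup>2 + (1 - \<theta>) * (dist c z)\<^sup>2) \<le> \<theta> * (dist x z)\<^sup>2"
      by (simp only: distrib_left mult.assoc)
    then show ?thesis using \<theta> by simp
  qed
  have "((\<lambda>\<theta>. (dist x c)\<^sup>2 + (1 - \<theta>) * (dist c z)\<^sup>2) \<longlongrightarrow> (dist x c)\<^sup>2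
    + (1 - 0) * (dist c z)\<^sup>2) (at_right 0)"
    by (intro tendsto_intros)
  moreover have "eventually (\<lambda>\<theta>. (dist x c)\<^sup>2 + (1 - \<theta>) * (dist c z)\<^sup>2 \<le> (dist x z)\<^sup>2) (at_right 0)"
    using eventually_at_right[of 0 "1::real"] by (auto intro!: exI[of _ 1] *)
  ultimately show ?thesis using tendsto_upperbound[OF _ _ trivial_limit_at_right_real] by force
qed

text \<open>
  Both diagonals of the quadrilateral \<open>x\<close>, \<open>x'\<close>, \<open>c'\<close>, \<open>c\<close> are bounded below because the angles
  at \<open>c\<close> and \<open>c'\<close> are at least right angles, and their squares are bounded above in sum by the
  quadrilateral inequality.
\<close>

lemma nearest_nonexpansive:
  fixes C :: "'a::metric_space set"
  assumes cat: "CAT0_space TYPE('a)" and conv: "geodesically_convex C"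
    and c: "nearest C x c" "nearest C x' c'"
  shows "dist c c' \<le> dist x x'"
proof -
  have "(dist x c)\<^sup>2 + (dist c c')\<^sup>2 \<le> (dist x c')\<^sup>2" "(dist x' c')\<^sup>2 + (dist c' c)\<^sup>2 \<le> (dist x' c)\<^sup>2"
    using nearest_obtuse[OF cat conv] c by (auto simp: nearest_def)
  moreover have "(dist x c')\<^sup>2 + (dist x' c)\<^sup>2
      \<le> (dist x x')\<^sup>2 + (dist x' c')\<^sup>2 + (dist c' c)\<^sup>2 + (dist x c)\<^sup>2"
    using CAT0_quadrilateral[OF cat, where p = x and q = x' and r = c' and s = c]
      by (simp only: dist_commute[of c x])
  ultimately have "(dist c c')\<^sup>2 \<le> (dist x x')\<^sup>2" unfolding dist_commute[of c' c] by linarith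
  then show ?thesis by (rule power2_le_imp_le) simp
qed

section \<open>Recognising flat half-planes\<close>

text \<open>
  The hypothesis \<open>O\<close> says that each vertical ray makes a non-acute angle with the bottom line.
  The quadrilateral inequality leaves no room for obtuse angles, which gives the distances to
  the points of the bottom line. Stewart's inequality on a vertical segment from the bottom line
  to height \<open>b\<close> then bounds the remaining distances from above. For the lower bound, the point
  at height \<open>b\<close> lies between those at heights \<open>a\<close> and \<open>2 * b\<close>; its distance is known, and the
  one at height \<open>2 * b\<close> is bounded above, so that Stewart's inequality bounds the one at height
  \<open>a\<close> from below.
\<close>

lemma half_plane_isometric:
  fixes f :: "real \<Rightarrow> real \<Rightarrow> 'a::metric_space"
  assumes cat: "CAT0_space TYPE('a)"
    and V: "\<And>t a b. 0 \<le> a \<Longrightarrow> 0 \<le> b \<Longrightarrow> dist (f t a) (f t b) = \<bar>a - b\<bar>"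
    and H: "\<And>s t a. 0 \<le> a \<Longrightarrow> dist (f s a) (f t a) = \<bar>s - t\<bar>"
    and O: "\<And>s t b. 0 \<le> b \<Longrightarrow> b\<^sup>2 + (s - t)\<^sup>2 \<le> (dist (f s b) (f t 0))\<^sup>2"
    and ab: "0 \<le> a" "0 \<le> b"
  shows "(dist (f s a) (f t b))\<^sup>2 = (s - t)\<^sup>2 + (a - b)\<^sup>2"
proof -
  have base: "(dist (f s b) (f t 0))\<^sup>2 = b\<^sup>2 + (s - t)\<^sup>2" if "0 \<le> b" for s t b
  proof -
    have "(dist (f s b) (f t 0))\<^sup>2 + (dist (f t b) (f s 0))\<^sup>2
        \<le> (dist (f s b) (f t b))\<^sup>2 + (dist (f t b) (f t 0))\<^sup>2 + (dist (f t 0) (f s 0))\<^sup>2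
          + (dist (f s 0) (f s b))\<^sup>2"
      by (rule CAT0_quadrilateral[OF cat])
    also have "\<dots> = 2 * (s - t)\<^sup>2 + 2 * b\<^sup>2"
      using that by (simp add: H V power2_commute[of t s])
    finally show ?thesis using O[OF that, of s t] O[OF that, of t s] power2_commute[of t s] by linarith
  qed
  have upper: "(dist (f s b) (f t a))\<^sup>2 \<le> (s - t)\<^sup>2 + (b - a)\<^sup>2" if "0 \<le> a" "a \<le> b" for s t a b
  proof (cases "b = 0")
    case True
    then show ?thesis using that by (simp add: H)
  next
    case False
    with that have b: "b > 0" by simp
    define \<theta> where "\<theta> = a / b"
    have \<theta>: "\<theta> * b = a" using b by (simp add: \<theta>_def)
    have r: "at_ratio \<theta> (f t 0) (f t b) (f t a)"
      using that b by (simp add: at_ratio_def V \<theta>_def field_simps)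
    have "(dist (f s b) (f t a))\<^sup>2 \<le> (1 - \<theta>) * (dist (f s b) (f t 0))\<^sup>2 + \<theta> * (dist (f s b) (f t b))\<^sup>2
        - \<theta> * (1 - \<theta>) * (dist (f t 0) (f t b))\<^sup>2"
      by (rule CAT0_stewart[OF cat r])
    also have "\<dots> = (1 - \<theta>) * (b\<^sup>2 + (s - t)\<^sup>2) + \<theta> * (s - t)\<^sup>2 - \<theta> * (1 - \<theta>) * b\<^sup>2"
      using b by (simp add: base H V)
    also have "\<dots> = (s - t)\<^sup>2 + (b - \<theta> * b)\<^sup>2"
      by (simp add: power2_eq_square algebra_simps)
    finally show ?thesis unfolding \<theta> .
  qed
  have lower: "(s - t)\<^sup>2 + (b - a)\<^sup>2 \<le> (dist (f s b) (f t a))\<^sup>2" if "0 \<le> a" "a \<le> b" for s t a b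
  proof (cases "a = b")
    case True
    then show ?thesis using that by (simp add: H)
  next
    case False
    define T where "T = (s - t)\<^sup>2"
    define F where "F = (dist (f s b) (f t a))\<^sup>2"
    define m where "m = 2 * b - a"
    define \<theta> where "\<theta> = (b - a) / m"
    have m: "m > 0" "b > 0" using that False by (auto simp: m_def)
    have \<theta>: "\<theta> * m = b - a" "(1 - \<theta>) * m = b" using m by (auto simp: \<theta>_def m_def field_simps)
    have \<theta>1: "0 \<le> \<theta>" "\<theta> \<le> 1" using that m by (auto simp: \<theta>_def m_def)
    have r: "at_ratio \<theta> (f t a) (f t (2 * b)) (f t b)"
      using that m \<theta> \<theta>1 by (simp add: at_ratio_def V m_def)
    have "(dist (f t (2 * b)) (f s b))\<^sup>2 \<le> (t - s)\<^sup>2 + (2 * b - b)\<^sup>2"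
      using m by (intro upper) auto
    then have far: "(dist (f s b) (f t (2 * b)))\<^sup>2 \<le> T + b\<^sup>2"
      by (simp add: dist_commute power2_commute T_def)
    have "T = (dist (f s b) (f t b))\<^sup>2" using m by (simp add: H T_def)
    also have "\<dots> \<le> (1 - \<theta>) * F + \<theta> * (dist (f s b) (f t (2 * b)))\<^sup>2
        - \<theta> * (1 - \<theta>) * (dist (f t a) (f t (2 * b)))\<^sup>2"
      unfolding F_def by (rule CAT0_stewart[OF cat r])
    also have "\<theta> * (dist (f s b) (f t (2 * b)))\<^sup>2 \<le> \<theta> * (T + b\<^sup>2)"
      using far \<theta>1 by (intro mult_left_mono)
    also have "dist (f t a) (f t (2 * b)) = m" using that m by (simp add: V m_def)
    finally have "T \<le> (1 - \<theta>) * F + \<theta> * (T + b\<^sup>2) - \<theta> * (1 - \<theta>) * m\<^sup>2" by simp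
    then have "m * T \<le> m * ((1 - \<theta>) * F + \<theta> * (T + b\<^sup>2) - \<theta> * (1 - \<theta>) * m\<^sup>2)"
      using m by (intro mult_left_mono) auto
    also have "\<dots> = ((1 - \<theta>) * m) * F + (\<theta> * m) * (T + b\<^sup>2) - (\<theta> * m) * ((1 - \<theta>) * m) * m"
      by (simp add: power2_eq_square algebra_simps)
    also have "\<dots> = b * F + (b - a) * (T + b\<^sup>2) - (b - a) * b * m" unfolding \<theta> ..
    finally have "b * (T + (b - a)\<^sup>2) \<le> b * F"
      by (simp add: m_def power2_eq_square algebra_simps)
    then show ?thesis using m by (simp add: T_def F_def)
  qed
  show ?thesis
  proof (cases "b \<le> a")
    case True
    then show ?thesis using upper[of b a s t] lower[of b a s t] ab by force
  next
    case False
    then show ?thesis using upper[of a b t s] lower[of a b t s] ab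
      by (simp add: dist_commute power2_commute)
  qed
qed

section \<open>Ultralimits in compact sets\<close>

lemma nonprincipal_ultrafilterD:
  assumes "nonprincipal_ultrafilter \<omega>"
  shows "eventually P \<omega> \<or> eventually (\<lambda>i. \<not> P i) \<omega>" and "\<omega> \<noteq> bot"
  using assms by (auto simp: nonprincipal_ultrafilter_def)

text \<open>
  A nonprincipal ultrafilter gives measure zero to every point, hence to every initial segment.
\<close>

lemma ultrafilter_eventually_ge:
  fixes \<omega> :: "nat filter"
  assumes u: "nonprincipal_ultrafilter \<omega>"
  shows "eventually (\<lambda>n. k \<le> n) \<omega>"
proof -
  have ne: "eventually (\<lambda>n. n \<noteq> i) \<omega>" for i
  proof (rule ccontr)
    assume "\<not> ?thesis"
    then have ev: "eventually (\<lambda>n. n = i) \<omega>" using nonprincipal_ultrafilterD(1)[OF u, of "\<lambda>n. n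
      = i"] by simp
    have i: "eventually P \<omega> \<longleftrightarrow> P i" for P
    proof
      assume "eventually P \<omega>"
      then have "eventually (\<lambda>n. P i) \<omega>" using ev by eventually_elim simp
      then show "P i" using nonprincipal_ultrafilterD(2)[OF u] by (simp add: eventually_const)
    qed (use ev in \<open>auto elim: eventually_mono\<close>)
    have "\<omega> = principal {i}" by (rule filter_eqI) (simp add: i eventually_principal)
    then show False using u by (auto simp: nonprincipal_ultrafilter_def)
  qed
  have "eventually (\<lambda>n. \<forall>i\<in>{..<k}. n \<noteq> i) \<omega>" using ne by (simp add: eventually_ball_finite)
  then show ?thesis by (rule eventually_mono) (auto simp: not_less[symmetric])
qed

text \<open>
  In a compact set the image of the ultrafilter has a cluster point, and an ultrafilter
  converges to each of its cluster points.
\<close>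

lemma ultralimit_in_compact:
  fixes X :: "nat \<Rightarrow> 'a::metric_space"
  assumes u: "nonprincipal_ultrafilter \<omega>" and K: "compact K" "eventually (\<lambda>n. X n \<in> K) \<omega>"
  shows "\<exists>l\<in>K. (X \<longlongrightarrow> l) \<omega>"
proof -
  have "filtermap X \<omega> \<noteq> bot" using nonprincipal_ultrafilterD(2)[OF u] by (simp add: filtermap_bot_iff)
  moreover have "eventually (\<lambda>x. x \<in> K) (filtermap X \<omega>)" using K(2) by (simp add: eventually_filtermap)
  ultimately obtain l where l: "l \<in> K" "inf (nhds l) (filtermap X \<omega>) \<noteq> bot"
    using K(1) unfolding compact_filter by blast
  have "(X \<longlongrightarrow> l) \<omega>"
  proof (rule topological_tendstoI)
    fix S assume S: "open S" "l \<in> S"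
    show "eventually (\<lambda>n. X n \<in> S) \<omega>"
    proof (rule ccontr)
      assume "\<not> ?thesis"
      then have "eventually (\<lambda>x. x \<notin> S) (filtermap X \<omega>)"
        using nonprincipal_ultrafilterD(1)[OF u] by (auto simp: eventually_filtermap)
      moreover have "eventually (\<lambda>x. x \<in> S) (nhds l)" using S by (rule eventually_nhds_in_open)
      ultimately have "eventually (\<lambda>x. False) (inf (nhds l) (filtermap X \<omega>))"
        unfolding eventually_inf by blast
      with l show False by (simp add: trivial_limit_def)
    qed
  qed
  with l show ?thesis by blast
qed

section \<open>Properness of cocompact CAT(0) spaces\<close>

locale cocompact_CAT0 =
  fixes G :: "('g, 'm) monoid_scheme" and \<phi> :: "'g \<Rightarrow> 'a::metric_space \<Rightarrow> 'a"
  assumes cat: "CAT0_space TYPE('a)" and geom: "geometric_action G \<phi>"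
begin

lemma action: "group_action G UNIV \<phi>"
  and isometric: "g \<in> carrier G \<Longrightarrow> dist (\<phi> g x) (\<phi> g y) = dist x y"
  and proper_action: "\<exists>r>0. finite {g \<in> carrier G. \<phi> g ` ball x r \<inter> ball x r \<noteq> {}}"
  using geom by (auto simp: geometric_action_def)

lemma group: "group G"
  by (rule group_hom.axioms(1)[OF group_action.group_hom[OF action]])

lemma act_mult: "g \<in> carrier G \<Longrightarrow> h \<in> carrier G \<Longrightarrow> \<phi> (g \<otimes>\<^bsub>G\<^esub> h) x = \<phi> g (\<phi> h x)"
  using group_action.composition_rule[OF action] by simp

lemma act_inv_left: "g \<in> carrier G \<Longrightarrow> \<phi> (inv\<^bsub>G\<^esub> g) (\<phi> g x) = x"
  by (rule group_action.orbit_sym_aux[OF action]) simp_all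

lemma inv_carrier: "g \<in> carrier G \<Longrightarrow> inv\<^bsub>G\<^esub> g \<in> carrier G"
  by (rule group.inv_closed[OF group])

lemma act_inv_right: "g \<in> carrier G \<Longrightarrow> \<phi> g (\<phi> (inv\<^bsub>G\<^esub> g) x) = x"
  using act_inv_left[OF inv_carrier, of g] group.inv_inv[OF group, of g] by simp

lemma dist_act_shift: "g \<in> carrier G \<Longrightarrow> dist (\<phi> g x) y = dist x (\<phi> (inv\<^bsub>G\<^esub> g) y)"
  using isometric[of g x "\<phi> (inv\<^bsub>G\<^esub> g) y"] by (simp add: act_inv_right)

text \<open>
  If \<open>k\<close> and \<open>h\<close> both move \<open>x\<close> into a ball, then the product of \<open>h\<close> and the inverse of \<open>k\<close> moves
  a point of that ball to a point of it.
\<close>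

lemma finite_transporter:
  assumes r: "0 < r" and fin: "finite {g \<in> carrier G. \<phi> g ` ball y r \<inter> ball y r \<noteq> {}}"
  shows "finite {g \<in> carrier G. dist (\<phi> g x) y < r}" (is "finite ?A")
proof (cases "?A = {}")
  case False
  interpret Gr: group G by (rule group)
  from False obtain k where k: "k \<in> carrier G" "dist (\<phi> k x) y < r" by blast
  have "?A \<subseteq> (\<lambda>h. h \<otimes>\<^bsub>G\<^esub> k) ` {g \<in> carrier G. \<phi> g ` ball y r \<inter> ball y r \<noteq> {}}"
  proof
    fix h assume h: "h \<in> ?A"
    define j where "j = h \<otimes>\<^bsub>G\<^esub> inv\<^bsub>G\<^esub> k"
    have j: "j \<in> carrier G" "h = j \<otimes>\<^bsub>G\<^esub> k"
      using h k by (simp_all add: j_def Gr.m_assoc)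
    have "\<phi> j (\<phi> k x) = \<phi> h x" using j k act_mult by simp
    moreover have "\<phi> k x \<in> ball y r" "\<phi> h x \<in> ball y r" using h k by (auto simp: dist_commute)
    ultimately have "\<phi> j ` ball y r \<inter> ball y r \<noteq> {}" by (metis disjoint_iff imageI)
    with j show "h \<in> (\<lambda>h. h \<otimes>\<^bsub>G\<^esub> k) ` {g \<in> carrier G. \<phi> g ` ball y r \<inter> ball y r \<noteq> {}}" by blast
  qed
  then show ?thesis using fin finite_surj by blast
qed (simp only: finite.emptyI)

text \<open>
  Properness of the action concerns small balls around single points. Finitely many of them,
  with radii shrunk to a quarter, cover \<open>K\<close>; an element that nearly maps a point of \<open>K\<close> to
  another moves the centre of one of the original balls into another one that is at least as
  large, or its inverse does.
\<close>

lemma finitely_many_translates_near: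
  assumes "compact K"
  shows "\<exists>\<eta>>0. finite {g \<in> carrier G. \<exists>x\<in>K. \<exists>y\<in>K. dist (\<phi> g x) y < \<eta>}"
proof -
  have "\<forall>x. \<exists>r>0. finite {g \<in> carrier G. \<phi> g ` ball x r \<inter> ball x r \<noteq> {}}"
    using proper_action by blast
  from choice[OF this] obtain r where r: "\<And>x. r x > 0"
      "\<And>x. finite {g \<in> carrier G. \<phi> g ` ball x (r x) \<inter> ball x (r x) \<noteq> {}}"
    by blast
  have K: "K \<subseteq> (\<Union>x\<in>K. ball x (r x / 4))" using r(1) by force
  obtain I where I: "I \<subseteq> K" "finite I" "K \<subseteq> (\<Union>x\<in>I. ball x (r x / 4))"
    by (rule compactE_image[of K K "\<lambda>x. ball x (r x / 4)", OF assms open_ball K])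
  show ?thesis
  proof (cases "I = {}")
    case True
    then show ?thesis using I by (intro exI[of _ 1]) auto
  next
    case False
    define \<eta> where "\<eta> = Min (r ` I) / 4"
    have \<eta>: "\<eta> > 0" "\<And>i. i \<in> I \<Longrightarrow> \<eta> \<le> r i / 4"
      using False I r(1) by (auto simp: \<eta>_def)
    define T where "T i j = {g \<in> carrier G. dist (\<phi> g i) j < r j}" for i j
    have T: "finite (T i j)" for i j unfolding T_def by (rule finite_transporter[OF r])
    have "{g \<in> carrier G. \<exists>x\<in>K. \<exists>y\<in>K. dist (\<phi> g x) y < \<eta>}
        \<subseteq> (\<Union>i\<in>I. \<Union>j\<in>I. T i j \<union> (\<lambda>g. inv\<^bsub>G\<^esub> g) ` T j i)"
    proof
      fix g assume "g \<in> {g \<in> carrier G. \<exists>x\<in>K. \<exists>y\<in>K. dist (\<phi> g x) y < \<eta>}"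
      then obtain x y where g: "g \<in> carrier G" and xy: "x \<in> K" "y \<in> K" "dist (\<phi> g x) y < \<eta>" by blast
      from xy(1) I(3) obtain i where i: "i \<in> I" "dist i x < r i / 4" by auto
      from xy(2) I(3) obtain j where j: "j \<in> I" "dist j y < r j / 4" by auto
      note ij = i(1) j(1) i(2) j(2)
      have "dist (\<phi> g i) j \<le> dist (\<phi> g i) (\<phi> g x) + dist (\<phi> g x) y + dist y j"
        using dist_triangle[of "\<phi> g i" j "\<phi> g x"] dist_triangle[of "\<phi> g x" j y] by linarith
      then have d: "dist (\<phi> g i) j < r i / 4 + \<eta> + r j / 4"
        using ij xy g by (simp add: isometric dist_commute)
      show "g \<in> (\<Union>i\<in>I. \<Union>j\<in>I. T i j \<union> (\<lambda>g. inv\<^bsub>G\<^esub> g) ` T j i)"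
      proof (cases "r i \<le> r j")
        case True
        then have "dist (\<phi> g i) j < r j" using d \<eta>(2)[OF ij(2)] r(1)[of j] by linarith
        then have "g \<in> T i j" using g by (simp add: T_def)
        then show ?thesis using ij by blast
      next
        case False
        have "dist (\<phi> (inv\<^bsub>G\<^esub> g) j) i = dist (\<phi> g i) j"
          using dist_act_shift[OF g, of i j] by (simp add: dist_commute)
        then have "dist (\<phi> (inv\<^bsub>G\<^esub> g) j) i < r i" using False d \<eta>(2)[OF ij(1)] r(1)[of i] by linarith
        then have "inv\<^bsub>G\<^esub> g \<in> T j i" using inv_carrier[OF g] by (simp add: T_def)
        moreover have "g = inv\<^bsub>G\<^esub> (inv\<^bsub>G\<^esub> g)" using group.inv_inv[OF group g] by simp
        ultimately show ?thesis using ij by blast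
      qed
    qed
    moreover have "finite (\<Union>i\<in>I. \<Union>j\<in>I. T i j \<union> (\<lambda>g. inv\<^bsub>G\<^esub> g) ` T j i)" using I T by auto
    ultimately show ?thesis using \<eta>(1) finite_subset by blast
  qed
qed

lemma act_compact: "g \<in> carrier G \<Longrightarrow> compact K \<Longrightarrow> compact (\<phi> g ` K)"
  by (intro compact_continuous_image continuous_onI) (auto simp: isometric)

definition fundamental_compact :: "'a set" where
  "fundamental_compact = (SOME K. compact K \<and> (\<Union>g\<in>carrier G. \<phi> g ` K) = UNIV)"

lemma fundamental_compact: "compact fundamental_compact"
    "(\<Union>g\<in>carrier G. \<phi> g ` fundamental_compact) = UNIV"
  using someI_ex[of "\<lambda>K. compact K \<and> (\<Union>g\<in>carrier G. \<phi> g ` K) = UNIV"] geom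
  unfolding fundamental_compact_def geometric_action_def by blast+

lemma move_to_fundamental: "\<exists>g\<in>carrier G. \<phi> g x \<in> fundamental_compact"
proof -
  obtain g k where "g \<in> carrier G" "k \<in> fundamental_compact" "x = \<phi> g k"
    using fundamental_compact(2) by blast
  then show ?thesis using act_inv_left inv_carrier by metis
qed

text \<open>
  Near a point of the fundamental compact set only finitely many of its translates are seen, and
  they cover a neighbourhood of uniform size; cocompactness carries this to all points.
\<close>

lemma uniformly_locally_compact:
  "\<exists>\<eta>>0. \<forall>x::'a. \<exists>M. compact M \<and> ball x \<eta> \<subseteq> M"
proof -
  define K where "K = fundamental_compact"
  obtain \<eta> where \<eta>: "\<eta> > 0" "finite {g \<in> carrier G. \<exists>x\<in>K. \<exists>y\<in>K. dist (\<phi> g x) y < \<eta>}" (is "finite ?F")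
    using finitely_many_translates_near[OF fundamental_compact(1)] unfolding K_def by blast
  define M where "M = (\<Union>g\<in>?F. \<phi> g ` K)"
  have "compact M"
    unfolding M_def using \<eta>(2) fundamental_compact(1)
      by (intro compact_UN act_compact) (auto simp: K_def)
  have M: "ball x \<eta> \<subseteq> M" if "x \<in> K" for x
  proof
    fix y assume y: "y \<in> ball x \<eta>"
    obtain g k where "g \<in> carrier G" "k \<in> K" "y = \<phi> g k"
      using fundamental_compact(2) unfolding K_def by blast
    with y that show "y \<in> M" unfolding M_def by (auto simp: dist_commute)
  qed
  have "\<exists>M. compact M \<and> ball x \<eta> \<subseteq> M" for x :: 'a
  proof -
    obtain g where g: "g \<in> carrier G" "\<phi> g x \<in> K" using move_to_fundamental K_def by blast
    have "ball x \<eta> \<subseteq> \<phi> (inv\<^bsub>G\<^esub> g) ` M"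
    proof
      fix y assume "y \<in> ball x \<eta>"
      then have "\<phi> g y \<in> M" using M[OF g(2)] g(1) by (auto simp: isometric)
      then show "y \<in> \<phi> (inv\<^bsub>G\<^esub> g) ` M" using act_inv_left[OF g(1), of y] by force
    qed
    then show ?thesis using act_compact[OF inv_carrier[OF g(1)] \<open>compact M\<close>] by blast
  qed
  with \<eta>(1) show ?thesis by blast
qed

text \<open>
  The Hopf-Rinow argument: a ball of radius \<open>r\<close> that lies in a compact set is covered by
  finitely many small balls, and doubling these covers the ball of radius \<open>r + \<eta> / 2\<close>,
  because every point of it can be reached along a geodesic.
\<close>

lemma compact_cball: "compact (cball (x::'a) R)"
proof -
  obtain \<eta> where \<eta>: "\<eta> > 0" and ex: "\<forall>x::'a. \<exists>M. compact M \<and> ball x \<eta> \<subseteq> M"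
    using uniformly_locally_compact by blast
  from choice[OF ex] obtain M :: "'a \<Rightarrow> 'a set" where M: "\<And>x. compact (M x)" "\<And>x. ball x \<eta> \<subseteq> M x"
    by blast
  have *: "\<exists>N. compact N \<and> cball x (real n * (\<eta> / 2)) \<subseteq> N" for n
  proof (induction n)
    case 0
    show ?case by (intro exI[of _ "{x}"]) auto
  next
    case (Suc n)
    then obtain N where N: "compact N" "cball x (real n * (\<eta> / 2)) \<subseteq> N" by blast
    have cover: "N \<subseteq> (\<Union>y\<in>N. ball y (\<eta> / 2))" using \<eta> by force
    obtain Y where Y: "Y \<subseteq> N" "finite Y" "N \<subseteq> (\<Union>y\<in>Y. ball y (\<eta> / 2))"
      by (rule compactE_image[of N N "\<lambda>y. ball y (\<eta> / 2)", OF N(1) open_ball cover])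
    have "cball x (real (Suc n) * (\<eta> / 2)) \<subseteq> (\<Union>y\<in>Y. M y)"
    proof
      fix z assume z: "z \<in> cball x (real (Suc n) * (\<eta> / 2))"
      define t where "t = min (dist x z) (real n * (\<eta> / 2))"
      obtain c where c: "c 0 = x" "c (dist x z) = z" "unit_speed c (dist x z)"
        using CAT0_geodesic[OF cat, of x z] by metis
      have t: "0 \<le> t" "t \<le> dist x z" "t \<le> real n * (\<eta> / 2)" using \<eta> by (auto simp: t_def)
      have "dist x z - t \<le> \<eta> / 2" using z \<eta> by (auto simp: t_def algebra_simps)
      then have cz: "dist (c t) z \<le> \<eta> / 2" using unit_speedD[OF c(3), of t "dist x z"] c(2) t by simp
      have "dist x (c t) = t" using unit_speedD[OF c(3), of 0 t] c(1) t by simp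
      then have "c t \<in> N" using t N by auto
      then obtain y where y: "y \<in> Y" "dist y (c t) < \<eta> / 2" using Y by auto
      then have "dist y z < \<eta>" using dist_triangle[of y z "c t"] cz by linarith
      then show "z \<in> (\<Union>y\<in>Y. M y)" using y M(2)[of y] by auto
    qed
    moreover have "compact (\<Union>y\<in>Y. M y)" using Y M by blast
    ultimately show ?case by blast
  qed
  obtain n :: nat where "R / (\<eta> / 2) \<le> real n" using real_arch_simple by blast
  then have "R \<le> real n * (\<eta> / 2)" using \<eta> by (simp add: field_simps)
  then obtain N where "compact N" "cball x R \<subseteq> N"
    using *[of n] subset_cball by (metis order_trans)
  then show ?thesis using compact_Int_closed[of N "cball x R"] by (simp add: Int_absorb1)
qed

lemma nearest_exists:
  assumes "closed C" "(C :: 'a set) \<noteq> {}"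
  shows "\<exists>c. nearest C x c"
proof -
  obtain z where z: "z \<in> C" using assms by blast
  have "compact (cball x (dist x z) \<inter> C)" using compact_cball assms by (intro compact_Int_closed)
  moreover have "cball x (dist x z) \<inter> C \<noteq> {}" using z by auto
  ultimately obtain c where c: "c \<in> cball x (dist x z) \<inter> C" "\<And>y. y \<in> cball x (dist x z) \<inter> C
    \<Longrightarrow> dist x c \<le> dist x y"
    using continuous_attains_inf[of "cball x (dist x z) \<inter> C" "dist x"]
      continuous_on_dist[OF continuous_on_const continuous_on_id] by blast
  have "dist x c \<le> dist x y" if "y \<in> C" for y
    using c that by (cases "dist x y \<le> dist x z") auto
  then show ?thesis using c by (auto simp: nearest_def)
qed

text \<open>
  Ultralimits take the place of the Arzela-Ascoli theorem: the limit exists at every \<open>v\<close> at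
  once, with no passage to subsequences.
\<close>

lemma translated_ultralimit:
  fixes h :: "nat \<Rightarrow> 'v \<Rightarrow> 'a"
  assumes u: "nonprincipal_ultrafilter \<omega>"
    and bdd: "\<And>v. eventually (\<lambda>n. dist (h n v0) (h n v) \<le> B v) \<omega>"
  shows "\<exists>g f. (\<forall>n. g n \<in> carrier G) \<and> (\<forall>v. ((\<lambda>n. \<phi> (g n) (h n v)) \<longlongrightarrow> f v) \<omega>)"
proof -
  have "\<exists>g. g \<in> carrier G \<and> \<phi> g (h n v0) \<in> fundamental_compact" for n
    using move_to_fundamental by blast
  then obtain g where g: "\<And>n. g n \<in> carrier G" "\<And>n. \<phi> (g n) (h n v0) \<in> fundamental_compact" by metis
  obtain x e where e: "fundamental_compact \<subseteq> cball x e"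
    using compact_imp_bounded[OF fundamental_compact(1)] bounded_subset_cball by metis
  have "\<exists>l. ((\<lambda>n. \<phi> (g n) (h n v)) \<longlongrightarrow> l) \<omega>" for v
  proof -
    have "eventually (\<lambda>n. \<phi> (g n) (h n v) \<in> cball x (e + B v)) \<omega>"
      using bdd[of v]
    proof (rule eventually_mono)
      fix n assume "dist (h n v0) (h n v) \<le> B v"
      moreover have "dist x (\<phi> (g n) (h n v0)) \<le> e" using g(2)[of n] e by auto
      ultimately show "\<phi> (g n) (h n v) \<in> cball x (e + B v)"
        using dist_triangle[of x "\<phi> (g n) (h n v)" "\<phi> (g n) (h n v0)"] g(1) by (simp add: isometric)
    qed
    from ultralimit_in_compact[OF u compact_cball this] show ?thesis by blast
  qed
  then show ?thesis using g(1) by metis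
qed

end

section \<open>Flat half-planes deep inside lie near a member of the family\<close>

lemma tubular_nbhd_iff: "y \<in> tubular_nbhd r C \<longleftrightarrow> (\<exists>c\<in>C. dist c y < r)"
  by (simp add: tubular_nbhd_def)

lemma tubular_nbhd_near:
  assumes "y \<in> tubular_nbhd r C" "dist y z < e" "r + e \<le> r'"
  shows "z \<in> tubular_nbhd r' C"
proof -
  from assms(1) obtain c where "c \<in> C" "dist c y < r" by (auto simp: tubular_nbhd_iff)
  moreover have "dist c z \<le> dist c y + dist y z" by (rule dist_triangle)
  ultimately show ?thesis using assms(2,3) by (auto simp: tubular_nbhd_iff intro!: bexI[of _ c])
qed

lemma tubular_nbhd_mono: "r \<le> r' \<Longrightarrow> tubular_nbhd r C \<subseteq> tubular_nbhd r' C"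
  by (force simp: tubular_nbhd_iff)

lemma flat_plane:
  fixes f :: "real \<Rightarrow> real \<Rightarrow> 'a::metric_space"
  assumes "\<And>s a t b. (dist (f s a) (f t b))\<^sup>2 = (s - t)\<^sup>2 + (a - b)\<^sup>2"
  shows "flat (range (\<lambda>(s, a). f s a))"
proof -
  have "range (\<lambda>(s, a). f s a) = (\<lambda>u. f (u 0) (u 1)) ` topspace (Euclidean_space 2)"
  proof
    show "range (\<lambda>(s, a). f s a) \<subseteq> (\<lambda>u. f (u 0) (u 1)) ` topspace (Euclidean_space 2)"
    proof
      fix x assume "x \<in> range (\<lambda>(s, a). f s a)"
      then obtain s a where x: "x = f s a" by auto
      show "x \<in> (\<lambda>u. f (u 0) (u 1)) ` topspace (Euclidean_space 2)"
        by (rule image_eqI[of _ _ "\<lambda>i. if i = 0 then s else if i = 1 then a else 0"])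
           (auto simp: x topspace_Euclidean_space)
    qed
  qed auto
  moreover have "dist (f (u 0) (u 1)) (f (v 0) (v 1)) = L2_set (\<lambda>i. u i - v i) {..<2}"
    for u v :: "nat \<Rightarrow> real"
    using real_sqrt_unique[OF assms[of "u 0" "u 1" "v 0" "v 1"]]
    by (simp add: L2_set_def lessThan_nat_numeral lessThan_Suc add.commute)
  ultimately show ?thesis unfolding flat_def by (intro exI[of _ 2]) blast
qed

locale isolated_family = cocompact_CAT0 G \<phi>
  for G :: "('g, 'm) monoid_scheme" and \<phi> :: "'g \<Rightarrow> 'a::metric_space \<Rightarrow> 'a" +
  fixes \<F> :: "'a set set" and D :: real
  assumes invariant: "\<And>g C. g \<in> carrier G \<Longrightarrow> C \<in> \<F> \<Longrightarrow> \<phi> g ` C \<in> \<F>"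
    and members: "\<And>C. C \<in> \<F> \<Longrightarrow> C \<noteq> {} \<and> closed C \<and> geodesically_convex C"
    and D: "0 \<le> D" "\<And>S. flat S \<Longrightarrow> \<exists>C\<in>\<F>. S \<subseteq> tubular_nbhd D C"
    and isolated: "\<And>r. r > 0 \<Longrightarrow> \<exists>\<rho>. \<forall>C\<in>\<F>. \<forall>C'\<in>\<F>. C \<noteq> C' \<longrightarrow>
              bounded (tubular_nbhd r C \<inter> tubular_nbhd r C') \<and>
              diameter (tubular_nbhd r C \<inter> tubular_nbhd r C') < \<rho>"
begin

text \<open>
  Condition (B) in the form in which it is used: two points that are far from each other
  determine a member of the family near both.
\<close>

lemma same_member:
  assumes "r > 0"
  obtains \<rho> where "\<rho> > 0" "\<And>C C' u v. \<lbrakk>C \<in> \<F>; C' \<in> \<F>; u \<in> tubular_nbhd r C; u \<in> tubular_nbhd r C';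
    v \<in> tubular_nbhd r C; v \<in> tubular_nbhd r C'; \<rho> \<le> dist u v\<rbrakk> \<Longrightarrow> C = C'"
proof -
  obtain \<rho> where \<rho>: "\<And>C C'. C \<in> \<F> \<Longrightarrow> C' \<in> \<F> \<Longrightarrow> C \<noteq> C' \<Longrightarrow>
              bounded (tubular_nbhd r C \<inter> tubular_nbhd r C') \<and>
              diameter (tubular_nbhd r C \<inter> tubular_nbhd r C') < \<rho>"
    using isolated[OF assms] by blast
  show thesis
  proof (rule that[of "max \<rho> 1"])
    fix C C' u v
    assume *: "C \<in> \<F>" "C' \<in> \<F>" "u \<in> tubular_nbhd r C" "u \<in> tubular_nbhd r C'"
      "v \<in> tubular_nbhd r C" "v \<in> tubular_nbhd r C'" "max \<rho> 1 \<le> dist u v"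
    show "C = C'"
    proof (rule ccontr)
      assume "C \<noteq> C'"
      then have "dist u v < \<rho>"
        using \<rho>[OF *(1,2)] diameter_bounded_bound[of "tubular_nbhd r C \<inter> tubular_nbhd r C'" u v] *(3-6)
        by force
      with *(7) show False by simp
    qed
  qed simp
qed

lemma tubular_nbhd_act:
  assumes "g \<in> carrier G" "\<phi> g y \<in> tubular_nbhd r C"
  shows "y \<in> tubular_nbhd r (\<phi> (inv\<^bsub>G\<^esub> g) ` C)"
proof -
  obtain c where c: "c \<in> C" "dist c (\<phi> g y) < r" using assms(2) by (auto simp: tubular_nbhd_iff)
  have "dist (\<phi> (inv\<^bsub>G\<^esub> g) c) y = dist c (\<phi> g y)"
    using dist_act_shift[OF assms(1), of y c] by (simp add: dist_commute)
  with c show ?thesis by (auto simp: tubular_nbhd_iff intro!: bexI[of _ c])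
qed

text \<open>
  Around points at greater and greater depth the half-plane looks like a whole plane, so the
  ultralimit of its translates is a flat, which (A) places near some member. The three points on
  a line are chosen so that triples starting at \<open>t\<close> and at \<open>t + k\<close> overlap in two points at
  distance \<open>k\<close>.
\<close>

lemma deep_points_near_member:
  fixes f :: "real \<Rightarrow> real \<Rightarrow> 'a" and \<omega> :: "nat filter"
  assumes u: "nonprincipal_ultrafilter \<omega>"
    and f: "\<And>s a t b. 0 \<le> a \<Longrightarrow> 0 \<le> b \<Longrightarrow> (dist (f s a) (f t b))\<^sup>2 = (s - t)\<^sup>2 + (a - b)\<^sup>2"
  shows "\<exists>a0. \<forall>t. \<forall>a\<ge>a0. \<exists>C\<in>\<F>. {f t a, f (t + k) a, f (t + 2 * k) a} \<subseteq> tubular_nbhd (D + 1) C"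
proof (rule ccontr)
  assume "\<not> ?thesis"
  then have "\<forall>n::nat. \<exists>ta. snd ta \<ge> real n \<and> (\<forall>C\<in>\<F>. \<not> {f (fst ta) (snd ta), f (fst ta
    + k) (snd ta), f (fst ta + 2 * k) (snd ta)} \<subseteq> tubular_nbhd (D + 1) C)"
    by (metis fst_conv snd_conv)
  from choice[OF this] obtain ta where ta: "\<And>n. snd (ta n) \<ge> real n"
    "\<And>n C. C \<in> \<F> \<Longrightarrow> \<not> {f (fst (ta n)) (snd (ta n)), f (fst (ta n) + k) (snd (ta n)), f (fst (ta n)
      + 2 * k) (snd (ta n))} \<subseteq> tubular_nbhd (D + 1) C"
    by blast
  define T A where "T n = fst (ta n)" and "A n = snd (ta n)" for n
  have A: "A n \<ge> real n" for n using ta(1) by (simp add: A_def)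
  \<comment> \<open>the maximum with 0 only matters for those \<open>n\<close> for which \<open>v\<close> would fall below the bottom line\<close>
  define h where "h n v = f (T n + fst v) (max 0 (A n + snd v))" for n and v :: "real \<times> real"
  have bdd: "eventually (\<lambda>n. dist (h n (0, 0)) (h n v) \<le> \<bar>fst v\<bar> + \<bar>snd v\<bar>) \<omega>" for v
  proof (rule always_eventually, rule allI, rule power2_le_imp_le)
    fix n
    have An: "A n \<ge> 0" using A[of n] by linarith
    have "(dist (h n (0, 0)) (h n v))\<^sup>2 = (fst v)\<^sup>2 + (A n - max 0 (A n + snd v))\<^sup>2"
      using An by (simp add: h_def f)
    also have "(A n - max 0 (A n + snd v))\<^sup>2 \<le> (snd v)\<^sup>2"
      using An by (intro abs_le_square_iff[THEN iffD1]) (auto simp: max_def)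
    also have "(fst v)\<^sup>2 + (snd v)\<^sup>2 \<le> (\<bar>fst v\<bar> + \<bar>snd v\<bar>)\<^sup>2"
      by (simp add: power2_sum)
    finally show "(dist (h n (0, 0)) (h n v))\<^sup>2 \<le> (\<bar>fst v\<bar> + \<bar>snd v\<bar>)\<^sup>2" by simp
  qed auto
  obtain g F where g: "\<And>n. g n \<in> carrier G" and F: "\<And>v. ((\<lambda>n. \<phi> (g n) (h n v)) \<longlongrightarrow> F v) \<omega>"
    using translated_ultralimit[where h = h and B = "\<lambda>v. \<bar>fst v\<bar> + \<bar>snd v\<bar>", OF u bdd] by blast
  have F_dist: "(dist (F (s, a)) (F (t, b)))\<^sup>2 = (s - t)\<^sup>2 + (a - b)\<^sup>2" for s a t b
  proof (rule tendsto_unique[OF nonprincipal_ultrafilterD(2)[OF u]])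
    show "((\<lambda>n. (dist (\<phi> (g n) (h n (s, a))) (\<phi> (g n) (h n (t, b))))\<^sup>2) \<longlongrightarrow> (dist (F (s, a)) (F (t, b)))\<^sup>2) \<omega>"
      by (intro tendsto_intros F)
    obtain N :: nat where N: "\<bar>a\<bar> + \<bar>b\<bar> \<le> real N" using real_arch_simple by blast
    have "eventually (\<lambda>n. (dist (\<phi> (g n) (h n (s, a))) (\<phi> (g n) (h n (t, b))))\<^sup>2 = (s - t)\<^sup>2
      + (a - b)\<^sup>2) \<omega>"
      using ultrafilter_eventually_ge[OF u, of N]
    proof (rule eventually_mono)
      fix n assume "N \<le> n"
      then have "0 \<le> A n + a" "0 \<le> A n + b" using N A[of n] by linarith+
      then show "(dist (\<phi> (g n) (h n (s, a))) (\<phi> (g n) (h n (t, b))))\<^sup>2 = (s - t)\<^sup>2 + (a - b)\<^sup>2"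
        using g by (simp add: isometric h_def f)
    qed
    then show "((\<lambda>n. (dist (\<phi> (g n) (h n (s, a))) (\<phi> (g n) (h n (t, b))))\<^sup>2) \<longlongrightarrow> (s - t)\<^sup>2 + (a - b)\<^sup>2) \<omega>"
      by (simp add: tendsto_eventually)
  qed
  obtain C where C: "C \<in> \<F>" "range (\<lambda>(s, a). F (s, a)) \<subseteq> tubular_nbhd D C"
    using D(2)[OF flat_plane[of "\<lambda>s a. F (s, a)", OF F_dist]] by blast
  have near: "eventually (\<lambda>n. \<phi> (g n) (h n v) \<in> tubular_nbhd (D + 1) C) \<omega>" for v
  proof -
    have "F v \<in> tubular_nbhd D C" using C(2) by (cases v) auto
    moreover have "eventually (\<lambda>n. dist (\<phi> (g n) (h n v)) (F v) < 1) \<omega>"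
      using F tendstoD zero_less_one by blast
    ultimately show ?thesis
      by (auto elim!: eventually_mono intro: tubular_nbhd_near simp: dist_commute)
  qed
  have "eventually (\<lambda>n. \<phi> (g n) (h n (0, 0)) \<in> tubular_nbhd (D + 1) C
    \<and> \<phi> (g n) (h n (k, 0)) \<in> tubular_nbhd (D + 1) C
      \<and> \<phi> (g n) (h n (2 * k, 0)) \<in> tubular_nbhd (D + 1) C) \<omega>"
    by (intro eventually_conj near)
  then obtain n where n: "\<phi> (g n) (h n (0, 0)) \<in> tubular_nbhd (D + 1) C"
    "\<phi> (g n) (h n (k, 0)) \<in> tubular_nbhd (D + 1) C"
      "\<phi> (g n) (h n (2 * k, 0)) \<in> tubular_nbhd (D + 1) C"
    using eventually_happens'[OF nonprincipal_ultrafilterD(2)[OF u]] by blast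
  have "A n \<ge> 0" using A[of n] by linarith
  then have "{f (T n) (A n), f (T n + k) (A n), f (T n + 2 * k) (A n)}
    \<subseteq> tubular_nbhd (D + 1) (\<phi> (inv\<^bsub>G\<^esub> (g n)) ` C)"
    using n[THEN tubular_nbhd_act[OF g]] by (simp add: h_def)
  with ta(2)[of "\<phi> (inv\<^bsub>G\<^esub> (g n)) ` C" n] invariant[OF inv_carrier[OF g] C(1)] show False
    by (simp add: T_def A_def)
qed

text \<open>
  With \<open>k\<close> larger than the bound of (B), consecutive triples of points are near the same member,
  and so are all of them.
\<close>

lemma deep_line_near_member:
  fixes f :: "real \<Rightarrow> real \<Rightarrow> 'a" and \<omega> :: "nat filter"
  assumes u: "nonprincipal_ultrafilter \<omega>"
    and f: "\<And>s a t b. 0 \<le> a \<Longrightarrow> 0 \<le> b \<Longrightarrow> (dist (f s a) (f t b))\<^sup>2 = (s - t)\<^sup>2 + (a - b)\<^sup>2"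
  shows "\<exists>k>0. \<exists>a0. \<forall>a\<ge>a0. 0 \<le> a \<longrightarrow> (\<exists>C\<in>\<F>. \<forall>j::nat. f (real j * k) a \<in> tubular_nbhd (D + 1) C)"
proof -
  obtain k where k: "k > 0" "\<And>C C' u v. \<lbrakk>C \<in> \<F>; C' \<in> \<F>; u \<in> tubular_nbhd (D + 1) C;
    u \<in> tubular_nbhd (D + 1) C';
    v \<in> tubular_nbhd (D + 1) C; v \<in> tubular_nbhd (D + 1) C'; k \<le> dist u v\<rbrakk> \<Longrightarrow> C = C'"
    by (rule same_member[of "D + 1"]) (use D(1) in auto)
  obtain a0 where a0: "\<forall>t. \<forall>a\<ge>a0. \<exists>C\<in>\<F>. {f t a, f (t + k) a, f (t + 2 * k) a} \<subseteq> tubular_nbhd (D + 1) C"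
    using deep_points_near_member[OF u f] by blast
  have "\<exists>C\<in>\<F>. \<forall>j::nat. f (real j * k) a \<in> tubular_nbhd (D + 1) C" if a: "a0 \<le> a" "0 \<le> a" for a
  proof -
    have "\<forall>j::nat. \<exists>C. C \<in> \<F> \<and> {f (real j * k) a, f (real j * k + k) a, f (real j * k + 2 * k) a}
      \<subseteq> tubular_nbhd (D + 1) C"
      using a0 a by blast
    from choice[OF this] obtain C where C: "\<And>j::nat. C j \<in> \<F>"
        "\<And>j. {f (real j * k) a, f (real j * k + k) a, f (real j * k + 2 * k) a}
          \<subseteq> tubular_nbhd (D + 1) (C j)"
      by blast
    have "C (Suc j) = C j" for j
    proof (rule k(2)[OF C(1) C(1)])
      have e: "real (Suc j) * k = real j * k + k" "real (Suc j) * k + k = real j * k + 2 * k"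
        by (simp_all add: algebra_simps)
      show "f (real j * k + k) a \<in> tubular_nbhd (D + 1) (C (Suc j))"
        using C(2)[of "Suc j"] unfolding insert_subset e(1) by blast
      show "f (real j * k + 2 * k) a \<in> tubular_nbhd (D + 1) (C (Suc j))"
        using C(2)[of "Suc j"] unfolding insert_subset e(2) by blast
      show "f (real j * k + k) a \<in> tubular_nbhd (D + 1) (C j)"
        "f (real j * k + 2 * k) a \<in> tubular_nbhd (D + 1) (C j)"
        using C(2)[of j] by auto
      have "(dist (f (real j * k + k) a) (f (real j * k + 2 * k) a))\<^sup>2 = k\<^sup>2" using a by (simp add: f)
      then show "k \<le> dist (f (real j * k + k) a) (f (real j * k + 2 * k) a)"
        using k(1) by (simp add: power2_eq_iff_nonneg)
    qed
    then have "C j = C 0" for j by (induction j) auto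
    then show ?thesis using C by (metis insert_subset)
  qed
  with k(1) show ?thesis by blast
qed

section \<open>Fences\<close>

text \<open>
  A fence of size \<open>N\<close> consists of posts \<open>h s\<close>, one for each \<open>s\<close> between \<open>- N\<close> and \<open>N\<close>, which
  stand perpendicularly on \<open>C\<close> and are at least \<open>N\<close> high. The error terms vanish as \<open>N\<close> grows
  with \<open>s\<close>, \<open>t\<close>, \<open>a\<close> fixed, so that a limit of fences satisfies exactly the hypotheses of
  \<open>half_plane_isometric\<close>.
\<close>

definition fence :: "'a set \<Rightarrow> nat \<Rightarrow> (real \<Rightarrow> real \<Rightarrow> 'a) \<Rightarrow> bool" where
  "fence C N h \<longleftrightarrow> (\<forall>s\<in>{- real N..real N}. \<forall>t\<in>{- real N..real N}. \<forall>a\<in>{0..real N}.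
     h s 0 \<in> C \<and> (\<forall>z\<in>C. a \<le> dist (h s a) z) \<and>
     (\<forall>b\<in>{0..real N}. dist (h s a) (h s b) = \<bar>a - b\<bar>) \<and>
     \<bar>s - t\<bar> - 1 / real N \<le> dist (h s a) (h t a) \<and>
     dist (h s a) (h t a) \<le> \<bar>s - t\<bar> + a * \<bar>s - t\<bar> / real N \<and>
     a\<^sup>2 + (dist (h s 0) (h t 0))\<^sup>2 \<le> (dist (h s a) (h t 0))\<^sup>2)"

lemma fenceD:
  assumes "fence C N h" "\<bar>s\<bar> \<le> real N" "\<bar>t\<bar> \<le> real N" "0 \<le> a" "a \<le> real N"
  shows "h s 0 \<in> C" "z \<in> C \<Longrightarrow> a \<le> dist (h s a) z"
    "0 \<le> b \<Longrightarrow> b \<le> real N \<Longrightarrow> dist (h s a) (h s b) = \<bar>a - b\<bar>"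
    "\<bar>s - t\<bar> - 1 / real N \<le> dist (h s a) (h t a)"
    "dist (h s a) (h t a) \<le> \<bar>s - t\<bar> + a * \<bar>s - t\<bar> / real N"
    "a\<^sup>2 + (dist (h s 0) (h t 0))\<^sup>2 \<le> (dist (h s a) (h t 0))\<^sup>2"
proof -
  have "s \<in> {- real N..real N}" "t \<in> {- real N..real N}" "a \<in> {0..real N}" using assms by auto
  with assms(1) have *: "h s 0 \<in> C \<and> (\<forall>z\<in>C. a \<le> dist (h s a) z) \<and>
     (\<forall>b\<in>{0..real N}. dist (h s a) (h s b) = \<bar>a - b\<bar>) \<and>
     \<bar>s - t\<bar> - 1 / real N \<le> dist (h s a) (h t a) \<and>
     dist (h s a) (h t a) \<le> \<bar>s - t\<bar> + a * \<bar>s - t\<bar> / real N \<and>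
     a\<^sup>2 + (dist (h s 0) (h t 0))\<^sup>2 \<le> (dist (h s a) (h t 0))\<^sup>2"
    unfolding fence_def by blast
  then show "h s 0 \<in> C" "z \<in> C \<Longrightarrow> a \<le> dist (h s a) z"
    "0 \<le> b \<Longrightarrow> b \<le> real N \<Longrightarrow> dist (h s a) (h s b) = \<bar>a - b\<bar>"
    "\<bar>s - t\<bar> - 1 / real N \<le> dist (h s a) (h t a)"
    "dist (h s a) (h t a) \<le> \<bar>s - t\<bar> + a * \<bar>s - t\<bar> / real N"
    "a\<^sup>2 + (dist (h s 0) (h t 0))\<^sup>2 \<le> (dist (h s a) (h t 0))\<^sup>2"
    by simp_all
qed

text \<open>
  The three hypotheses of \<open>half_plane_isometric\<close> are closed conditions on finitely many points,
  so they pass to the ultralimit. Each single post belongs to all but finitely many of the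
  fences.
\<close>

lemma fences_converge_to_half_plane:
  fixes \<omega> :: "nat filter"
  assumes u: "nonprincipal_ultrafilter \<omega>" and fence: "\<And>n. fence (C n) (Suc n) (h n)"
  obtains g f where "\<And>n. g n \<in> carrier G"
    "\<And>s a. 0 \<le> a \<Longrightarrow> ((\<lambda>n. \<phi> (g n) (h n s a)) \<longlongrightarrow> f s a) \<omega>"
    "\<And>s a t b. 0 \<le> a \<Longrightarrow> 0 \<le> b \<Longrightarrow> (dist (f s a) (f t b))\<^sup>2 = (s - t)\<^sup>2 + (a - b)\<^sup>2"
proof -
  have large: "eventually (\<lambda>n. x \<le> real (Suc n)) \<omega>" for x
  proof -
    obtain m :: nat where "x \<le> real m" using real_arch_simple by blast
    then show ?thesis
      using ultrafilter_eventually_ge[OF u, of m] by (auto elim!: eventually_mono)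
  qed
  have bdd: "eventually (\<lambda>n. dist (h n (fst (0, 0)) \<bar>snd (0, 0)\<bar>) (h n (fst v) \<bar>snd v\<bar>)
    \<le> \<bar>fst v\<bar> + \<bar>snd v\<bar>) \<omega>"
    for v :: "real \<times> real"
    using large[of "\<bar>fst v\<bar>"] large[of "\<bar>snd v\<bar>"]
  proof eventually_elim
    fix n assume n: "\<bar>fst v\<bar> \<le> real (Suc n)" "\<bar>snd v\<bar> \<le> real (Suc n)"
    have "dist (h n 0 0) (h n (fst v) 0) \<le> \<bar>fst v\<bar>"
      using fenceD(5)[OF fence, of 0 n "fst v" 0] n by simp
    moreover have "dist (h n (fst v) 0) (h n (fst v) \<bar>snd v\<bar>) = \<bar>snd v\<bar>"
      using fenceD(3)[OF fence, of "fst v" n "fst v" 0 "\<bar>snd v\<bar>"] n by simp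
    ultimately show "dist (h n (fst (0, 0)) \<bar>snd (0, 0)\<bar>) (h n (fst v) \<bar>snd v\<bar>) \<le> \<bar>fst v\<bar> + \<bar>snd v\<bar>"
      using dist_triangle[of "h n 0 0" "h n (fst v) \<bar>snd v\<bar>" "h n (fst v) 0"] by simp
  qed
  obtain g F where g: "\<And>n. g n \<in> carrier G"
    and F: "\<And>v. ((\<lambda>n. \<phi> (g n) (h n (fst v) \<bar>snd v\<bar>)) \<longlongrightarrow> F v) \<omega>"
    using translated_ultralimit[OF u, of "\<lambda>n v. h n (fst v) \<bar>snd v\<bar>" "(0, 0)", OF bdd] by blast
  define f where "f s a = F (s, a)" for s a
  have f: "((\<lambda>n. \<phi> (g n) (h n s a)) \<longlongrightarrow> f s a) \<omega>" if "0 \<le> a" for s a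
    using F[of "(s, a)"] that by (simp add: f_def)
  have d: "((\<lambda>n. dist (h n s a) (h n t b)) \<longlongrightarrow> dist (f s a) (f t b)) \<omega>" if "0 \<le> a" "0 \<le> b" for s a t b
    using tendsto_dist[OF f[of a s] f[of b t]] that g by (simp add: isometric)
  have seq: "\<omega> \<le> sequentially"
    unfolding le_filter_def eventually_sequentially
    by (auto intro: eventually_mono[OF ultrafilter_eventually_ge[OF u]])
  have inv: "((\<lambda>n. x / real (Suc n)) \<longlongrightarrow> 0) \<omega>" for x
    by (rule tendsto_mono[OF seq]) (rule LIMSEQ_Suc[OF lim_const_over_n])
  note ne = nonprincipal_ultrafilterD(2)[OF u]
  have V: "dist (f t a) (f t b) = \<bar>a - b\<bar>" if "0 \<le> a" "0 \<le> b" for t a b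
  proof (rule tendsto_unique[OF ne d[OF that]])
    have "eventually (\<lambda>n. dist (h n t a) (h n t b) = \<bar>a - b\<bar>) \<omega>"
      using large[of "\<bar>t\<bar>"] large[of a] large[of b]
      by eventually_elim (rule fenceD(3)[OF fence], use that in auto)
    then show "((\<lambda>n. dist (h n t a) (h n t b)) \<longlongrightarrow> \<bar>a - b\<bar>) \<omega>" by (rule tendsto_eventually)
  qed
  have H: "dist (f s a) (f t a) = \<bar>s - t\<bar>" if a: "0 \<le> a" for s t a
  proof (rule antisym)
    have "eventually (\<lambda>n. dist (h n s a) (h n t a) \<le> \<bar>s - t\<bar> + a * \<bar>s - t\<bar> / real (Suc n)) \<omega>"
      using large[of "\<bar>s\<bar>"] large[of "\<bar>t\<bar>"] large[of a]
      by eventually_elim (rule fenceD(5)[OF fence], use a in auto)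
    from tendsto_le[OF ne tendsto_add[OF tendsto_const inv] d[OF a a] this]
    show "dist (f s a) (f t a) \<le> \<bar>s - t\<bar>" by simp
    have "eventually (\<lambda>n. \<bar>s - t\<bar> - 1 / real (Suc n) \<le> dist (h n s a) (h n t a)) \<omega>"
      using large[of "\<bar>s\<bar>"] large[of "\<bar>t\<bar>"] large[of a]
      by eventually_elim (rule fenceD(4)[OF fence], use a in auto)
    from tendsto_le[OF ne d[OF a a] tendsto_diff[OF tendsto_const inv] this]
    show "\<bar>s - t\<bar> \<le> dist (f s a) (f t a)" by simp
  qed
  have O: "b\<^sup>2 + (s - t)\<^sup>2 \<le> (dist (f s b) (f t 0))\<^sup>2" if b: "0 \<le> b" for s t b
  proof -
    have "eventually (\<lambda>n. b\<^sup>2 + (dist (h n s 0) (h n t 0))\<^sup>2 \<le> (dist (h n s b) (h n t 0))\<^sup>2) \<omega>"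
      using large[of "\<bar>s\<bar>"] large[of "\<bar>t\<bar>"] large[of b]
      by eventually_elim (rule fenceD(6)[OF fence], use b in auto)
    from tendsto_le[OF ne tendsto_power[OF d] tendsto_add[OF tendsto_const tendsto_power[OF d]] this]
    have "b\<^sup>2 + (dist (f s 0) (f t 0))\<^sup>2 \<le> (dist (f s b) (f t 0))\<^sup>2" using b by simp
    then show ?thesis by (simp add: H)
  qed
  show thesis by (rule that[OF g f half_plane_isometric[OF cat V H O]])
qed

text \<open>
  The limit half-plane at height \<open>a\<close> is near one member \<open>E\<close>, and it stays within about \<open>a\<close> of
  the translated base of a sufficiently large fence along a segment as long as desired. Hence
  \<open>E\<close> is that base, which is impossible because the posts are at distance \<open>a\<close> from their base at
  height \<open>a\<close>.
\<close>

lemma no_arbitrarily_large_fences: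
  fixes \<omega> :: "nat filter"
  assumes u: "nonprincipal_ultrafilter \<omega>" and ex: "\<And>N. 0 < N \<Longrightarrow> \<exists>C\<in>\<F>. \<exists>h. fence C N h"
  shows False
proof -
  have "\<forall>n. \<exists>Ch. fst Ch \<in> \<F> \<and> fence (fst Ch) (Suc n) (snd Ch)" using ex by force
  from choice[OF this] obtain Ch where Ch: "\<And>n. fst (Ch n) \<in> \<F>
    \<and> fence (fst (Ch n)) (Suc n) (snd (Ch n))" by blast
  define C h where "C n = fst (Ch n)" and "h n = snd (Ch n)" for n
  have C: "\<And>n. C n \<in> \<F>" and fence: "\<And>n. fence (C n) (Suc n) (h n)"
    using Ch by (auto simp: C_def h_def)
  obtain g f where g: "\<And>n. g n \<in> carrier G"
    and lim: "\<And>s a. 0 \<le> a \<Longrightarrow> ((\<lambda>n. \<phi> (g n) (h n s a)) \<longlongrightarrow> f s a) \<omega>"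
    and f: "\<And>s a t b. 0 \<le> a \<Longrightarrow> 0 \<le> b \<Longrightarrow> (dist (f s a) (f t b))\<^sup>2 = (s - t)\<^sup>2 + (a - b)\<^sup>2"
    by (rule fences_converge_to_half_plane[OF u fence]) blast
  obtain k a0 where k: "k > 0" and a0: "\<And>a. a0 \<le> a \<Longrightarrow> 0 \<le> a
    \<Longrightarrow> \<exists>C\<in>\<F>. \<forall>j::nat. f (real j * k) a \<in> tubular_nbhd (D + 1) C"
    using deep_line_near_member[OF u f] by blast
  \<comment> \<open>\<open>D + 1\<close> for the distance to \<open>E\<close>, 1 for the approximation of the limit, and 1 to spare\<close>
  define a where "a = max a0 (D + 3)"
  have a: "a0 \<le> a" "0 \<le> a" "D + 3 \<le> a" using D(1) by (auto simp: a_def)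
  obtain E where E: "E \<in> \<F>" "\<And>j::nat. f (real j * k) a \<in> tubular_nbhd (D + 1) E"
    using a0[OF a(1,2)] by blast
  define r where "r = a + D + 2"
  have r: "r > 0" "D + 1 \<le> r" using a D(1) by (auto simp: r_def)
  obtain \<rho> where \<rho>: "\<rho> > 0" "\<And>C C' u v. \<lbrakk>C \<in> \<F>; C' \<in> \<F>; u \<in> tubular_nbhd r C; u \<in> tubular_nbhd r C';
    v \<in> tubular_nbhd r C; v \<in> tubular_nbhd r C'; \<rho> \<le> dist u v\<rbrakk> \<Longrightarrow> C = C'"
    by (rule same_member[OF r(1)]) blast
  obtain j :: nat where j: "\<rho> < real j * k" using reals_Archimedean3[OF k] by blast
  have close: "eventually (\<lambda>n. dist (\<phi> (g n) (h n s a)) (f s a) < 1) \<omega>" for s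
    by (rule tendstoD[OF lim[OF a(2)] zero_less_one])
  obtain m :: nat where m: "a + real j * k \<le> real m" using real_arch_simple by blast
  have "eventually (\<lambda>n. dist (\<phi> (g n) (h n 0 a)) (f 0 a) < 1 \<and>
      dist (\<phi> (g n) (h n (real j * k) a)) (f (real j * k) a) < 1 \<and> m \<le> n) \<omega>"
    by (intro eventually_conj close ultrafilter_eventually_ge[OF u])
  then obtain n where n: "dist (\<phi> (g n) (h n 0 a)) (f 0 a) < 1"
      "dist (\<phi> (g n) (h n (real j * k) a)) (f (real j * k) a) < 1" "m \<le> n"
    using eventually_happens'[OF nonprincipal_ultrafilterD(2)[OF u]] by blast
  have jk: "0 \<le> real j * k" using k by simp
  have big: "a \<le> real (Suc n)" "real j * k \<le> real (Suc n)" using m n(3) a(2) jk by linarith+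
  define C' where "C' = \<phi> (g n) ` C n"
  have C': "C' \<in> \<F>" using invariant[OF g C] by (simp add: C'_def)
  have nearC': "f s a \<in> tubular_nbhd r C'" if s: "\<bar>s\<bar> \<le> real (Suc n)"
    and d: "dist (\<phi> (g n) (h n s a)) (f s a) < 1" for s
  proof -
    have "h n s 0 \<in> C n" using fenceD(1)[OF fence s s, of 0] by simp
    moreover have "dist (h n s 0) (h n s a) = a"
      using fenceD(3)[OF fence s s, of 0 a] a big by simp
    then have "dist (\<phi> (g n) (h n s 0)) (f s a) < a + 1"
      using dist_triangle[of "\<phi> (g n) (h n s 0)" "f s a" "\<phi> (g n) (h n s a)"] d g
        by (simp add: isometric)
    ultimately show ?thesis using D(1) by (force simp: tubular_nbhd_iff C'_def r_def)
  qed
  have "E = C'"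
  proof (rule \<rho>(2)[OF E(1) C'])
    show "f 0 a \<in> tubular_nbhd r E" "f (real j * k) a \<in> tubular_nbhd r E"
      using E(2)[of 0] E(2)[of j] tubular_nbhd_mono[OF r(2)] by auto
    show "f 0 a \<in> tubular_nbhd r C'" "f (real j * k) a \<in> tubular_nbhd r C'"
      using nearC' n big jk by auto
    have "(dist (f 0 a) (f (real j * k) a))\<^sup>2 = (real j * k)\<^sup>2" using a by (simp add: f)
    then have "dist (f 0 a) (f (real j * k) a) = real j * k" using jk
      by (simp add: power2_eq_iff_nonneg)
    then show "\<rho> \<le> dist (f 0 a) (f (real j * k) a)" using j by simp
  qed
  then obtain z where z: "z \<in> C n" "dist (\<phi> (g n) z) (f 0 a) < D + 1"
    using E(2)[of 0] by (auto simp: tubular_nbhd_iff C'_def)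
  have "a \<le> dist (h n 0 a) z" using fenceD(2)[OF fence, of 0 n 0 a z] a big z(1) by simp
  also have "\<dots> = dist (\<phi> (g n) (h n 0 a)) (\<phi> (g n) z)" using g by (simp add: isometric)
  also have "\<dots> < D + 2" using dist_triangle2[of "\<phi> (g n) (h n 0 a)" "\<phi> (g n) z" "f 0 a"] n(1) z(2)
    by simp
  finally show False using a(3) by simp
qed

section \<open>Fences between long thin pairs\<close>

text \<open>
  The posts are the geodesics from the projections \<open>q t\<close> to the points \<open>p t\<close>. A point of such a
  geodesic has the same projection \<open>q t\<close>, which gives all lower bounds. The upper bound comes
  from the convexity of the metric; that compares points dividing the posts in equal ratios, and
  since the lengths of the posts are at least \<open>N\<close> and differ by at most \<open>\<bar>s - t\<bar>\<close>, the
  shift to equal heights costs at most \<open>a * \<bar>s - t\<bar> / N\<close>.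
\<close>

lemma fence_over_projected_segment:
  assumes N: "0 < N" and C: "C \<in> \<F>"
    and p: "\<And>s t. \<lbrakk>\<bar>s\<bar> \<le> real N; \<bar>t\<bar> \<le> real N\<rbrakk> \<Longrightarrow> dist (p s) (p t) = \<bar>s - t\<bar>"
    and q: "\<And>t. \<bar>t\<bar> \<le> real N \<Longrightarrow> nearest C (p t) (q t)"
    and far: "\<And>t. \<bar>t\<bar> \<le> real N \<Longrightarrow> real N \<le> dist (p t) (q t)"
    and ends: "2 * real N - 1 / real N \<le> dist (q (- real N)) (q (real N))"
  shows "\<exists>h. fence C N h"
proof -
  have conv: "geodesically_convex C" using members[OF C] by simp
  define w where "w t = dist (q t) (p t)" for t
  have "\<forall>t. \<exists>c. c 0 = q t \<and> c (w t) = p t \<and> unit_speed c (w t)"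
    unfolding w_def using CAT0_geodesic[OF cat] by metis
  from choice[OF this] obtain h where h: "\<And>t. h t 0 = q t" "\<And>t. h t (w t) = p t"
    "\<And>t. unit_speed (h t) (w t)"
    by blast
  have w: "real N \<le> w t" if "\<bar>t\<bar> \<le> real N" for t using far[OF that] by (simp add: w_def dist_commute)
  have near: "nearest C (h t a) (q t)" "dist (h t a) (q t) = a" if t: "\<bar>t\<bar> \<le> real N" and a: "0 \<le> a"
    "a \<le> w t" for t a
  proof -
    show d: "dist (h t a) (q t) = a"
      using unit_speedD[OF h(3)[of t], of a 0] a h(1) by simp
    have pa: "dist (p t) (h t a) = w t - a"
      using unit_speedD[OF h(3)[of t], of "w t" a] a h(2) by simp
    have "a \<le> dist (h t a) z" if z: "z \<in> C" for z
    proof -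
      have "w t \<le> dist (p t) z" using q[OF t] z by (simp add: nearest_def w_def dist_commute)
      then show ?thesis using dist_triangle[of "p t" z "h t a"] pa by linarith
    qed
    then show "nearest C (h t a) (q t)" using q[OF t] d by (simp add: nearest_def)
  qed
  have q_le: "dist (q s) (q t) \<le> \<bar>s - t\<bar>" if "\<bar>s\<bar> \<le> real N" "\<bar>t\<bar> \<le> real N" for s t
    using nearest_nonexpansive[OF cat conv q q, OF that] p[OF that] by simp
  have q_ge': "\<bar>s - t\<bar> - 1 / real N \<le> dist (q s) (q t)" if st: "\<bar>s\<bar> \<le> real N" "\<bar>t\<bar> \<le> real N"
    "s \<le> t" for s t
  proof -
    have "dist (q (- real N)) (q s) \<le> s + real N" using q_le[of "- real N" s] st by simp
    moreover have "dist (q t) (q (real N)) \<le> real N - t" using q_le[of t "real N"] st by simp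
    moreover have "dist (q (- real N)) (q (real N)) \<le> dist (q (- real N)) (q s) + dist (q s) (q t)
      + dist (q t) (q (real N))"
      using dist_triangle[of "q (- real N)" "q (real N)" "q s"] dist_triangle[of "q s" "q (real N)"
        "q t"] by linarith
    ultimately show ?thesis using ends st by simp
  qed
  have q_ge: "\<bar>s - t\<bar> - 1 / real N \<le> dist (q s) (q t)" if "\<bar>s\<bar> \<le> real N" "\<bar>t\<bar> \<le> real N" for s t
    using q_ge'[of s t] q_ge'[of t s] that
      by (cases "s \<le> t") (auto simp: dist_commute abs_minus_commute)
  have w_lip: "w s \<le> w t + \<bar>s - t\<bar>" if st: "\<bar>s\<bar> \<le> real N" "\<bar>t\<bar> \<le> real N" for s t
  proof -
    have "dist (p s) (q s) \<le> dist (p s) (q t)" using q[OF st(1)] q[OF st(2)] by (auto simp: nearest_def)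
    then have "w s \<le> dist (p s) (q t)" by (simp add: w_def dist_commute)
    also have "\<dots> \<le> dist (p s) (p t) + dist (p t) (q t)" by (rule dist_triangle)
    finally show ?thesis using p[OF st] by (simp add: w_def dist_commute)
  qed
  have upper: "dist (h s a) (h t a) \<le> \<bar>s - t\<bar> + a * \<bar>s - t\<bar> / real N"
    if st: "\<bar>s\<bar> \<le> real N" "\<bar>t\<bar> \<le> real N" and a: "0 \<le> a" "a \<le> real N" for s t a
  proof -
    define \<theta> where "\<theta> = a / w t"
    have wt: "w t > 0" "w s > 0" using w[OF st(1)] w[OF st(2)] N by linarith+
    have at: "a \<le> w t" "a \<le> w s" using a w st by force+
    have \<theta>: "\<theta> * w t = a" "0 \<le> \<theta>" "\<theta> \<le> 1" using wt a at by (auto simp: \<theta>_def)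
    have \<theta>s: "0 \<le> \<theta> * w s" "\<theta> * w s \<le> w s" using \<theta> wt mult_left_le_one_le[of "w s" \<theta>] by auto
    have r1: "at_ratio \<theta> (q t) (p t) (h t a)"
      using unit_speed_at_ratio[OF h(3)[of t], of 0 a "w t"] wt a at h by (simp add: \<theta>_def)
    have r2: "at_ratio \<theta> (q s) (p s) (h s (\<theta> * w s))"
      using unit_speed_at_ratio[OF h(3)[of s], of 0 "\<theta> * w s" "w s"] wt \<theta>s h by simp
    have "dist (h s (\<theta> * w s)) (h t a) \<le> (1 - \<theta>) * dist (q s) (q t) + \<theta> * dist (p s) (p t)"
      by (rule CAT0_convex_metric[OF cat r2 r1])
    also have "\<dots> \<le> (1 - \<theta>) * \<bar>s - t\<bar> + \<theta> * \<bar>s - t\<bar>"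
      using \<theta> q_le[OF st] p[OF st] by (intro add_mono mult_left_mono) auto
    also have "\<dots> = \<bar>s - t\<bar>" by (simp add: algebra_simps)
    finally have 1: "dist (h s (\<theta> * w s)) (h t a) \<le> \<bar>s - t\<bar>" .
    have "dist (h s a) (h s (\<theta> * w s)) = \<bar>\<theta> * w t - \<theta> * w s\<bar>"
      using unit_speedD[OF h(3)[of s], of a "\<theta> * w s"] a at \<theta>s \<theta>(1) by simp
    also have "\<dots> = \<theta> * \<bar>w t - w s\<bar>"
      by (simp only: right_diff_distrib[symmetric] abs_mult abs_of_nonneg[OF \<theta>(2)])
    also have "\<dots> \<le> \<theta> * \<bar>s - t\<bar>"
    proof (rule mult_left_mono)
      show "\<bar>w t - w s\<bar> \<le> \<bar>s - t\<bar>" using w_lip[OF st] w_lip[OF st(2,1)] by linarith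
    qed (rule \<theta>(2))
    also have "\<dots> \<le> a / real N * \<bar>s - t\<bar>"
      unfolding \<theta>_def using w[OF st(2)] a N by (intro mult_right_mono divide_left_mono) auto
    finally show ?thesis using 1 dist_triangle[of "h s a" "h t a" "h s (\<theta> * w s)"] by simp
  qed
  have "fence C N h"
    unfolding fence_def
  proof (intro ballI conjI)
    fix s t a assume "s \<in> {- real N..real N}" "t \<in> {- real N..real N}" "a \<in> {0..real N}"
    then have st: "\<bar>s\<bar> \<le> real N" "\<bar>t\<bar> \<le> real N" and a: "0 \<le> a" "a \<le> real N" by auto
    have at: "a \<le> w t" "a \<le> w s" using a w st by force+
    show "h s 0 \<in> C" using q[OF st(1)] by (simp add: h nearest_def)
    show "a \<le> dist (h s a) z" if "z \<in> C" for z
      using near[OF st(1) a(1) at(2)] that by (auto simp: nearest_def)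
    show "dist (h s a) (h s b) = \<bar>a - b\<bar>" if "b \<in> {0..real N}" for b
      using unit_speedD[OF h(3)[of s], of a b] that a at w[OF st(1)] by simp
    show "\<bar>s - t\<bar> - 1 / real N \<le> dist (h s a) (h t a)"
      using q_ge[OF st] nearest_nonexpansive[OF cat conv near(1)[OF st(1) a(1) at(2)]
        near(1)[OF st(2) a(1) at(1)]]
      by linarith
    show "dist (h s a) (h t a) \<le> \<bar>s - t\<bar> + a * \<bar>s - t\<bar> / real N" by (rule upper[OF st a])
    have "h t 0 \<in> C" using q[OF st(2)] by (simp add: h nearest_def)
    then show "a\<^sup>2 + (dist (h s 0) (h t 0))\<^sup>2 \<le> (dist (h s a) (h t 0))\<^sup>2"
      using nearest_obtuse[OF cat conv near(1)[OF st(1) a(1) at(2)]] near(2)[OF st(1) a(1) at(2)]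
        by (simp add: h)
  qed
  then show ?thesis by blast
qed

text \<open>
  Project the segment from \<open>x'\<close> to \<open>y'\<close> to \<open>C\<close>. By (B) the points of the segment that are close
  to \<open>C\<close> are within \<open>\<rho>\<close> of each other, so the first or the last third of the segment avoids
  them. On that third the projection shortens distances by at most \<open>2 * \<epsilon> * L\<close> in
  total. It is cut into about \<open>L / (6 * N)\<close> pieces of length \<open>2 * N\<close>, and the choice of
  \<open>\<epsilon>\<close> leaves one of them on which the loss is at most \<open>1 / N\<close>.
\<close>

lemma fence_between_long_thin_pair:
  assumes N: "0 < N"
  obtains \<epsilon> L0 where "\<epsilon> > 0"
    "\<And>C C' x y x' y'. \<lbrakk>C \<in> \<F>; C' \<in> \<F>; C \<noteq> C'; x \<in> C; y \<in> C; x' \<in> C'; y' \<in> C'; L0 \<le> dist x' y';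
       dist x x' \<le> \<epsilon> * dist x' y'; dist y y' \<le> \<epsilon> * dist x' y'\<rbrakk> \<Longrightarrow> \<exists>h. fence C N h"
proof -
  obtain \<rho> where \<rho>: "\<rho> > 0" "\<And>C C' u v. \<lbrakk>C \<in> \<F>; C' \<in> \<F>; u \<in> tubular_nbhd (real N) C;
    u \<in> tubular_nbhd (real N) C';
    v \<in> tubular_nbhd (real N) C; v \<in> tubular_nbhd (real N) C'; \<rho> \<le> dist u v\<rbrakk> \<Longrightarrow> C = C'"
    by (rule same_member[of "real N"]) (use N in auto)
  define \<epsilon> where "\<epsilon> = 1 / (24 * (real N)\<^sup>2)"
  define L0 where "L0 = 3 * \<rho> + 12 * real N"
  have \<epsilon>: "\<epsilon> > 0" using N by (simp add: \<epsilon>_def)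
  show thesis
  proof (rule that[OF \<epsilon>, of L0])
    fix C C' x y x' y'
    assume C: "C \<in> \<F>" "C' \<in> \<F>" "C \<noteq> C'" and xy: "x \<in> C" "y \<in> C" "x' \<in> C'" "y' \<in> C'"
      and L0: "L0 \<le> dist x' y'" and thin: "dist x x' \<le> \<epsilon> * dist x' y'" "dist y y' \<le> \<epsilon> * dist x' y'"
    define L where "L = dist x' y'"
    have L: "3 * \<rho> \<le> L" "12 * real N \<le> L" "0 < L" using L0 \<rho>(1) N by (auto simp: L_def L0_def)
    have conv: "geodesically_convex C" using members[OF C(1)] by simp
    obtain c where c: "c 0 = x'" "c L = y'" "unit_speed c L" "geodesic_segment x' y' (c ` {0..L})"
      using CAT0_geodesic[OF cat, of x' y'] unfolding L_def by metis
    have cC: "c t \<in> C'" if "0 \<le> t" "t \<le> L" for t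
    proof -
      have "c ` {0..L} \<subseteq> C'" using members[OF C(2)] c(4) xy(3,4) unfolding geodesically_convex_def
        by blast
      with that show ?thesis by auto
    qed
    have "\<forall>t. \<exists>z. nearest C (c t) z" using nearest_exists members[OF C(1)] by blast
    from choice[OF this] obtain q where q: "\<And>t. nearest C (c t) (q t)" by blast
    have q_le: "dist (q s) (q t) \<le> \<bar>s - t\<bar>" if "0 \<le> s" "s \<le> L" "0 \<le> t" "t \<le> L" for s t
      using nearest_nonexpansive[OF cat conv q q, of s t] unit_speedD[OF c(3) that] by simp
    have bad: "\<bar>s - t\<bar> < \<rho>"
      if st: "0 \<le> s" "s \<le> L" "0 \<le> t" "t \<le> L" "dist (c s) (q s) < real N"
        "dist (c t) (q t) < real N" for s t
    proof (rule ccontr)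
      assume "\<not> \<bar>s - t\<bar> < \<rho>"
      then have "\<rho> \<le> dist (c s) (c t)" using unit_speedD[OF c(3) st(1-4)] by simp
      moreover have "c u \<in> tubular_nbhd (real N) C \<and> c u \<in> tubular_nbhd (real N) C'"
        if "0 \<le> u" "u \<le> L" "dist (c u) (q u) < real N" for u
      proof -
        have "q u \<in> C" using q by (simp add: nearest_def)
        moreover have "dist (q u) (c u) < real N" using that(3) by (simp add: dist_commute)
        moreover have "dist (c u) (c u) < real N" using N by simp
        ultimately show ?thesis using cC[OF that(1,2)] unfolding tubular_nbhd_iff by blast
      qed
      ultimately have "C = C'" using \<rho>(2)[OF C(1,2)] st by blast
      with C(3) show False ..
    qed
    obtain b where b: "0 \<le> b" "b + L / 3 \<le> L" and far: "\<And>t. b \<le> t \<Longrightarrow> t \<le> b + L / 3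
      \<Longrightarrow> real N \<le> dist (c t) (q t)"
    proof (cases "\<exists>s. 0 \<le> s \<and> s \<le> L / 3 \<and> dist (c s) (q s) < real N")
      case True
      then obtain s where s: "0 \<le> s" "s \<le> L / 3" "dist (c s) (q s) < real N" by blast
      show thesis
      proof (rule that[of "2 * L / 3"])
        fix t assume t: "2 * L / 3 \<le> t" "t \<le> 2 * L / 3 + L / 3"
        show "real N \<le> dist (c t) (q t)"
        proof (rule ccontr)
          assume "\<not> ?thesis"
          then have "\<bar>s - t\<bar> < \<rho>" using s t L by (intro bad) auto
          then show False using s t L by linarith
        qed
      qed (use L in auto)
    next
      case False
      then show thesis using L by (intro that[of 0]) (auto simp: not_less)
    qed
    have total: "L - 2 * \<epsilon> * L \<le> dist (q 0) (q L)"
    proof -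
      have "dist x' (q 0) \<le> dist x' x" "dist y' (q L) \<le> dist y' y"
        using q[of 0] q[of L] c(1,2) xy(1,2) by (auto simp: nearest_def)
      then have "dist x' (q 0) \<le> \<epsilon> * L" "dist y' (q L) \<le> \<epsilon> * L"
        using thin by (auto simp: L_def dist_commute)
      moreover have "L \<le> dist x' (q 0) + dist (q 0) (q L) + dist y' (q L)"
        using dist_triangle[of x' y' "q 0"] dist_triangle2[of "q 0" y' "q L"]
          by (simp add: L_def dist_commute)
      ultimately show ?thesis by simp
    qed
    have sub: "l - 2 * \<epsilon> * L \<le> dist (q b) (q (b + l))" if "0 \<le> l" "l \<le> L / 3" for l
    proof -
      have "dist (q 0) (q b) \<le> b" "dist (q (b + l)) (q L) \<le> L - (b + l)"
        using q_le[of 0 b] q_le[of "b + l" L] b that L by auto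
      moreover have "dist (q 0) (q L) \<le> dist (q 0) (q b) + dist (q b) (q (b + l)) + dist (q (b
        + l)) (q L)"
        using dist_triangle[of "q 0" "q L" "q b"] dist_triangle[of "q b" "q L" "q (b + l)"] by linarith
      ultimately show ?thesis using total by linarith
    qed
    \<comment> \<open>the number of pieces of length \<open>2 * N\<close> that fit into a third of the segment\<close>
    define M where "M = nat \<lfloor>L / (6 * real N)\<rfloor>"
    have M0: "real M = of_int \<lfloor>L / (6 * real N)\<rfloor>" using L N by (simp add: M_def)
    have M: "real M \<le> L / (6 * real N)" "L / (6 * real N) < real M + 1" unfolding M0 by linarith+
    have "1 \<le> L / (12 * real N)" using L N by simp
    then have M_large: "L / (12 * real N) < real M" using M(2) by simp
    have M2: "2 * real N * real M \<le> L / 3" using M(1) N by (simp add: field_simps)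
    define b' where "b' i = b + 2 * real N * real i" for i
    have "\<exists>i<M. 2 * real N - 1 / real N \<le> dist (q (b' i)) (q (b' (Suc i)))"
    proof (rule ccontr)
      assume "\<not> ?thesis"
      then have short: "dist (q (b' i)) (q (b' (Suc i))) \<le> 2 * real N - 1 / real N" if "i < M" for i
        using that by (meson le_cases not_le)
      have "dist (q (b' 0)) (q (b' i)) \<le> real i * (2 * real N - 1 / real N)" if "i \<le> M" for i
        using that
      proof (induction i)
        case (Suc i)
        then have "dist (q (b' 0)) (q (b' (Suc i))) \<le> real i * (2 * real N - 1 / real N)
          + (2 * real N - 1 / real N)"
          using dist_triangle[of "q (b' 0)" "q (b' (Suc i))" "q (b' i)"] short[of i] by simp
        then show ?case by (simp add: algebra_simps add_divide_distrib)
      qed simp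
      from this[of M] have "dist (q b) (q (b + 2 * real N * real M))
        \<le> real M * (2 * real N - 1 / real N)"
        by (simp add: b'_def)
      moreover have "2 * real N * real M - 2 * \<epsilon> * L \<le> dist (q b) (q (b + 2 * real N * real M))"
        using M2 by (intro sub) auto
      ultimately have "real M * (1 / real N) \<le> 2 * \<epsilon> * L" by (simp add: algebra_simps)
      also have "\<dots> = L / (12 * real N) * (1 / real N)" by (simp add: \<epsilon>_def power2_eq_square)
      also have "\<dots> < real M * (1 / real N)" using M_large N by (intro mult_strict_right_mono) auto
      finally show False by simp
    qed
    then obtain i where i: "i < M" "2 * real N - 1 / real N \<le> dist (q (b' i)) (q (b' (Suc i)))" by blast
    have "real (Suc i) \<le> real M" using i(1) by simp
    then have "2 * real N * real (Suc i) \<le> 2 * real N * real M" by (intro mult_left_mono) auto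
    then have range: "2 * real N * real i + 2 * real N \<le> L / 3" using M2 by (simp add: algebra_simps)
    define m where "m = b' i + real N"
    have m: "b \<le> m + t" "m + t \<le> b + L / 3" if "\<bar>t\<bar> \<le> real N" for t
      using range that mult_nonneg_nonneg[of "2 * real N" "real i"] by (auto simp: m_def b'_def)
    show "\<exists>h. fence C N h"
    proof (rule fence_over_projected_segment[OF N C(1), of "\<lambda>t. c (m + t)" "\<lambda>t. q (m + t)"])
      show "dist (c (m + s)) (c (m + t)) = \<bar>s - t\<bar>" if "\<bar>s\<bar> \<le> real N" "\<bar>t\<bar> \<le> real N" for s t
        using unit_speedD[OF c(3), of "m + s" "m + t"] m[OF that(1)] m[OF that(2)] b by simp
      show "nearest C (c (m + t)) (q (m + t))" for t by (rule q)
      show "real N \<le> dist (c (m + t)) (q (m + t))" if "\<bar>t\<bar> \<le> real N" for t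
        using far[OF m[OF that]] .
      have "m + - real N = b' i" "m + real N = b' (Suc i)" by (simp_all add: m_def b'_def algebra_simps)
      then show "2 * real N - 1 / real N \<le> dist (q (m + - real N)) (q (m + real N))" using i(2) by simp
    qed
  qed
qed

end

section \<open>Intersections in the asymptotic cone\<close>

lemma cone_rel_tendsto:
  assumes "nonprincipal_ultrafilter \<omega>" "(x, y) \<in> cone_rel \<omega> star lam"
  shows "((\<lambda>n. dist (x n) (y n) / lam n) \<longlongrightarrow> 0) \<omega>"
  using ulim_tendsto[OF assms(1), of "\<lambda>n. dist (x n) (y n) / lam n"] assms(2)
  by (simp add: cone_rel_def cone_dist_def zero_ereal_def)

lemma cone_dist_cong:
  assumes "eventually (\<lambda>n. x n = x' n \<and> y n = y' n) \<omega>"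
  shows "cone_dist \<omega> lam x y = cone_dist \<omega> lam x' y'"
proof -
  have "((\<lambda>n. ereal (dist (x n) (y n) / lam n)) \<longlongrightarrow> l) \<omega>
    \<longleftrightarrow> ((\<lambda>n. ereal (dist (x' n) (y' n) / lam n)) \<longlongrightarrow> l) \<omega>" for l
    by (rule tendsto_cong) (use assms in \<open>auto elim: eventually_mono\<close>)
  then show ?thesis unfolding cone_dist_def ulim_def Topological_Spaces.Lim_def by simp
qed

text \<open>
  Points of an ultralimit are represented by sequences with \<open>x n \<in> C n\<close> for \<^emph>\<open>every\<close>
  \<open>n\<close>, so the representative has to be changed at the negligible indices.
\<close>

lemma ulim_set_mono_eventually:
  assumes u: "nonprincipal_ultrafilter \<omega>" and lam: "\<And>n. lam n > 0"
    and ev: "eventually (\<lambda>n. C n = C' n) \<omega>" and ne: "\<And>n. C' n \<noteq> {}"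
  shows "ulim_set \<omega> star lam C \<subseteq> ulim_set \<omega> star lam C'"
proof
  fix P assume "P \<in> ulim_set \<omega> star lam C"
  then obtain x where P: "P \<in> asymptotic_cone \<omega> star lam" and x: "x \<in> P" "\<And>n. x n \<in> C n"
    by (auto simp: ulim_set_def)
  define x' where "x' n = (if C n = C' n then x n else (SOME z. z \<in> C' n))" for n
  have x': "x' n \<in> C' n" for n using x(2)[of n] ne[of n] by (auto simp: x'_def some_in_eq)
  have eq: "eventually (\<lambda>n. x n = x' n) \<omega>" using ev by eventually_elim (simp add: x'_def)
  note eqv = equiv_cone_rel[where lam = lam, OF u lam, of star]
  have xs: "x \<in> cone_seqs \<omega> star lam"
    using in_quotient_imp_subset[OF eqv] P x(1) by (auto simp: asymptotic_cone_def)
  have "cone_dist \<omega> lam x x' = cone_dist \<omega> lam x x"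
    by (rule cone_dist_cong) (use eq in \<open>auto elim: eventually_mono\<close>)
  moreover have "cone_dist \<omega> lam x' star = cone_dist \<omega> lam x star"
    by (rule cone_dist_cong) (use eq in \<open>auto elim: eventually_mono\<close>)
  ultimately have "(x, x') \<in> cone_rel \<omega> star lam"
    using xs cone_dist_refl[OF u, of lam x] by (simp add: cone_rel_def cone_seqs_def)
  then have "x' \<in> P" using in_quotient_imp_closed[OF eqv _ x(1)] P by (simp add: asymptotic_cone_def)
  then show "P \<in> ulim_set \<omega> star lam C'" using P x' by (auto simp: ulim_set_def)
qed

theorem proposition10:
  fixes G :: "('g, 'm) monoid_scheme"
    and \<phi> :: "'g \<Rightarrow> 'a::metric_space \<Rightarrow> 'a"
    and \<F> :: "'a set set"
    and \<omega> :: "nat filter"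
    and star :: "nat \<Rightarrow> 'a"
    and lam :: "nat \<Rightarrow> real"
    and C\<^sub>\<omega> C\<^sub>\<omega>' :: "(nat \<Rightarrow> 'a) set set"
  assumes "CAT0_space TYPE('a)"
    and "geometric_action G \<phi>"
    and "\<And>g C. g \<in> carrier G \<Longrightarrow> C \<in> \<F> \<Longrightarrow> \<phi> g ` C \<in> \<F>"
    and "\<And>C. C \<in> \<F> \<Longrightarrow> \<not> bounded C \<and> closed C \<and> geodesically_convex C"
    and A: "\<exists>D. \<forall>S. flat S \<longrightarrow> (\<exists>C\<in>\<F>. S \<subseteq> tubular_nbhd D C)"
    and B: "\<And>r. r > 0 \<Longrightarrow> \<exists>\<rho>. \<forall>C\<in>\<F>. \<forall>C'\<in>\<F>. C \<noteq> C' \<longrightarrow>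
              bounded (tubular_nbhd r C \<inter> tubular_nbhd r C') \<and>
              diameter (tubular_nbhd r C \<inter> tubular_nbhd r C') < \<rho>"
    and "nonprincipal_ultrafilter \<omega>"
    and "\<And>n. lam n > 0"
    and "filterlim lam at_top \<omega>"
    and "C\<^sub>\<omega> \<in> cone_family \<omega> star lam \<F>"
    and "C\<^sub>\<omega>' \<in> cone_family \<omega> star lam \<F>"
    and "C\<^sub>\<omega> \<noteq> C\<^sub>\<omega>'"
  shows "\<forall>P \<in> C\<^sub>\<omega> \<inter> C\<^sub>\<omega>'. \<forall>Q \<in> C\<^sub>\<omega> \<inter> C\<^sub>\<omega>'. P = Q"
proof (intro ballI, rule ccontr)
  fix P Q assume PQ: "P \<in> C\<^sub>\<omega> \<inter> C\<^sub>\<omega>'" "Q \<in> C\<^sub>\<omega> \<inter> C\<^sub>\<omega>'" "P \<noteq> Q"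
  note u = assms(7) and lam = assms(8)
  obtain D where D: "\<And>S. flat S \<Longrightarrow> \<exists>C\<in>\<F>. S \<subseteq> tubular_nbhd D C" using A by blast
  \<comment> \<open>enlarging a tubular neighbourhood preserves (A), so the constant may be taken nonnegative\<close>
  interpret isolated_family G \<phi> \<F> "max D 0"
  proof
    show "\<exists>C\<in>\<F>. S \<subseteq> tubular_nbhd (max D 0) C" if "flat S" for S
      using D[OF that] tubular_nbhd_mono[of D "max D 0"] by fastforce
    show "C \<noteq> {} \<and> closed C \<and> geodesically_convex C" if "C \<in> \<F>" for C
      using assms(4)[OF that] by auto
  qed (use assms in auto)
  obtain C where C: "C\<^sub>\<omega> = ulim_set \<omega> star lam C" "\<And>n. C n \<in> \<F>"
    using assms(10) by (auto simp: cone_family_def)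
  obtain C' where C': "C\<^sub>\<omega>' = ulim_set \<omega> star lam C'" "\<And>n. C' n \<in> \<F>"
    using assms(11) by (auto simp: cone_family_def)
  have distinct: "eventually (\<lambda>n. C n \<noteq> C' n) \<omega>"
  proof (rule ccontr)
    assume "\<not> ?thesis"
    then have ev: "eventually (\<lambda>n. C n = C' n) \<omega>"
      using nonprincipal_ultrafilterD(1)[OF u, of "\<lambda>n. C n = C' n"] by simp
    then have ev': "eventually (\<lambda>n. C' n = C n) \<omega>" by (simp add: eq_commute)
    have "C\<^sub>\<omega> = C\<^sub>\<omega>'"
      unfolding C C' using ulim_set_mono_eventually[OF u lam ev]
        ulim_set_mono_eventually[OF u lam ev'] members C(2) C'(2)
      by (intro subset_antisym) auto
    with assms(12) show False ..
  qed
  obtain x y where x: "x \<in> P" "\<And>n. x n \<in> C n" and y: "y \<in> Q" "\<And>n. y n \<in> C n"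
    using PQ C by (auto simp: ulim_set_def)
  obtain x' y' where x': "x' \<in> P" "\<And>n. x' n \<in> C' n" and y': "y' \<in> Q" "\<And>n. y' n \<in> C' n"
    using PQ C' by (auto simp: ulim_set_def)
  have cone: "P \<in> cone_seqs \<omega> star lam // cone_rel \<omega> star lam"
    "Q \<in> cone_seqs \<omega> star lam // cone_rel \<omega> star lam"
    using PQ C by (auto simp: ulim_set_def asymptotic_cone_def)
  note eqv = equiv_cone_rel[where lam = lam, OF u lam, of star]
  have lim: "((\<lambda>n. dist (x n) (x' n) / lam n) \<longlongrightarrow> 0) \<omega>" "((\<lambda>n. dist (y n) (y' n) / lam n) \<longlongrightarrow> 0) \<omega>"
    using in_quotient_imp_in_rel[OF eqv cone(1), of x x']
      in_quotient_imp_in_rel[OF eqv cone(2), of y y'] x x' y y'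
    by (auto intro!: cone_rel_tendsto[OF u])
  have "(x', y') \<notin> cone_rel \<omega> star lam"
    using quotient_eq_iff[OF eqv cone x'(1) y'(1)] PQ(3) by simp
  moreover have "x' \<in> cone_seqs \<omega> star lam" "y' \<in> cone_seqs \<omega> star lam"
    using in_quotient_imp_subset[OF eqv] cone x'(1) y'(1) by auto
  ultimately have "cone_dist \<omega> lam x' y' \<noteq> 0" by (simp add: cone_rel_def)
  then have "0 < cone_dist \<omega> lam x' y'" using cone_dist_nonneg[where lam = lam and x = x'
    and y = y', OF u lam] by (simp add: order_less_le)
  then obtain e where e: "0 < ereal e" "ereal e < cone_dist \<omega> lam x' y'" using ereal_dense2 by blast
  have "eventually (\<lambda>n. ereal e < ereal (dist (x' n) (y' n) / lam n)) \<omega>"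
    by (rule order_tendstoD(1)[OF ulim_tendsto[OF u] e(2)[unfolded cone_dist_def]])
  then have apart: "eventually (\<lambda>n. e < dist (x' n) (y' n) / lam n) \<omega>" by simp
  have "\<exists>C\<in>\<F>. \<exists>h. fence C N h" if N: "0 < N" for N
  proof -
    obtain \<epsilon> L0 where \<epsilon>: "\<epsilon> > 0" and
      fence: "\<And>C C' x y x' y'. \<lbrakk>C \<in> \<F>; C' \<in> \<F>; C \<noteq> C'; x \<in> C; y \<in> C; x' \<in> C'; y' \<in> C'; L0 \<le> dist x' y';
       dist x x' \<le> \<epsilon> * dist x' y'; dist y y' \<le> \<epsilon> * dist x' y'\<rbrakk> \<Longrightarrow> \<exists>h. fence C N h"
      by (rule fence_between_long_thin_pair[OF N]) blast
    have pos: "0 < \<epsilon> * e" using \<epsilon> e by simp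
    have "eventually (\<lambda>n. L0 / e \<le> lam n) \<omega>" using assms(9) by (simp add: filterlim_at_top)
    with distinct apart order_tendstoD(2)[OF lim(1) pos] order_tendstoD(2)[OF lim(2) pos]
    have "eventually (\<lambda>n. C n \<noteq> C' n \<and> e < dist (x' n) (y' n) / lam n
      \<and> dist (x n) (x' n) / lam n < \<epsilon> * e \<and>
        dist (y n) (y' n) / lam n < \<epsilon> * e \<and> L0 / e \<le> lam n) \<omega>"
      by eventually_elim simp
    then obtain n where n: "C n \<noteq> C' n" "e < dist (x' n) (y' n) / lam n"
      "dist (x n) (x' n) / lam n < \<epsilon> * e"
        "dist (y n) (y' n) / lam n < \<epsilon> * e" "L0 / e \<le> lam n"
      using eventually_happens'[OF nonprincipal_ultrafilterD(2)[OF u]] by blast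
    have e0: "0 < e" using e by simp
    have long: "e * lam n < dist (x' n) (y' n)" using n(2) lam[of n] by (simp add: pos_less_divide_eq)
    have "L0 \<le> dist (x' n) (y' n)" using n(5) long e0 by (simp add: pos_divide_le_eq mult.commute)
    moreover have "\<epsilon> * e * lam n \<le> \<epsilon> * dist (x' n) (y' n)" using long \<epsilon> by (simp add: mult.assoc)
    then have "dist (x n) (x' n) \<le> \<epsilon> * dist (x' n) (y' n)" "dist (y n) (y' n) \<le> \<epsilon> * dist (x' n) (y' n)"
      using n(3,4) lam[of n] by (auto simp: pos_divide_less_eq)
    ultimately have "\<exists>h. fence (C n) N h"
      using fence[OF C(2) C'(2) n(1) x(2) y(2) x'(2) y'(2)] by blast
    with C(2) show ?thesis by blast
  qed
  then show False by (rule no_arbitrarily_large_fences[OF u])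
qed

end
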